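(* For each complex-valued measurable function $b$ on $\mathbb T$ with $\operatorname{ess\,sup}_{z\in\mathbb T}|b(z)|^2<\frac12$, there is a unique measurable function $a$ on $\mathbb T$ such that $(a,b)\in\mathbf B$.
   Context: $\mathbb T$ is the unit circle, $\mathbb D$ the open unit disc, $\mathbb D^*=\{\overline z^{-1}:z\in\mathbb D\}\cup\{\infty\}$, $a^*(z)=\overline{a(\overline z^{-1})}$. $H^2(\mathbb D)$: functions in $L^2(\mathbb T)$ with vanishing negative Fourier coefficients; $H^2(\mathbb D^* )$: $f$ with $f^*\in H^2(\mathbb D)$; such $f$ extends analytically to $\mathbb D^*$ and $f(\infty)=\overline{f^*(0)}$. $\mathbf L$ is the set of pairs $(a,b)$ of measurable functions on $\mathbb T$ with $aa^*+bb^*=1$ a.e. on $\mathbb T$, $a\in H^2(\mathbb D^* )$ and $a(\infty)>0$. $\mathbf B$ is the set of $(a,b)\in\mathbf L$ with $\inf_{z\in\mathbb D^*}|a(z)|^2>\frac12$ (using the analytic extension of $a$ to $\mathbb D^*$). *)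

theory Defs
  imports "HOL-Analysis.Analysis" "HOL-Probability.Essential_Supremum"
begin

text \<open>Functions on the unit circle T are represented as functions complex \<Rightarrow> complex,
  of which only the values on T matter; T is parametrised by t \<mapsto> cis t, t \<in> [0, 2 pi],
  with (Lebesgue) arc-length measure.\<close>

definition circ_meas :: "real measure" where
  "circ_meas = lebesgue_on {0..2*pi}"

definition T_measurable :: "(complex \<Rightarrow> complex) \<Rightarrow> bool" where
  "T_measurable f \<longleftrightarrow> (\<lambda>t. f (cis t)) \<in> borel_measurable circ_meas"

definition L2T :: "(complex \<Rightarrow> complex) \<Rightarrow> bool" where
  "L2T f \<longleftrightarrow> T_measurable f \<and> integrable circ_meas (\<lambda>t. (cmod (f (cis t)))^2)"

definition fourier_coeff :: "(complex \<Rightarrow> complex) \<Rightarrow> int \<Rightarrow> complex" where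
  "fourier_coeff f n =
     (integral\<^sup>L circ_meas (\<lambda>t. f (cis t) * cis (- (of_int n * t)))) / complex_of_real (2*pi)"

definition H2_D :: "(complex \<Rightarrow> complex) \<Rightarrow> bool" where
  "H2_D f \<longleftrightarrow> L2T f \<and> (\<forall>n::int. n < 0 \<longrightarrow> fourier_coeff f n = 0)"

definition cstar :: "(complex \<Rightarrow> complex) \<Rightarrow> complex \<Rightarrow> complex" where
  "cstar f z = cnj (f (1 / cnj z))"

definition H2_Dstar :: "(complex \<Rightarrow> complex) \<Rightarrow> bool" where
  "H2_Dstar f \<longleftrightarrow> H2_D (cstar f)"

definition H2_ext :: "(complex \<Rightarrow> complex) \<Rightarrow> complex \<Rightarrow> complex" where
  "H2_ext f z = (\<Sum>n. fourier_coeff f (int n) * z ^ n)"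

definition Dstar_ext :: "(complex \<Rightarrow> complex) \<Rightarrow> complex \<Rightarrow> complex" where
  "Dstar_ext f w = cnj (H2_ext (cstar f) (1 / cnj w))"

definition at_infty :: "(complex \<Rightarrow> complex) \<Rightarrow> complex" where
  "at_infty f = cnj (H2_ext (cstar f) 0)"

definition L_pairs :: "((complex \<Rightarrow> complex) \<times> (complex \<Rightarrow> complex)) set" where
  "L_pairs = {(a, b). T_measurable a \<and> T_measurable b \<and>
      (AE t in circ_meas. a (cis t) * cstar a (cis t) + b (cis t) * cstar b (cis t) = 1) \<and>
      H2_Dstar a \<and> Im (at_infty a) = 0 \<and> Re (at_infty a) > 0}"

text \<open>D^* = {w. |w| > 1} \<union> {\<infinity>}; the infimum over D^* of |a|^2.\<close>
definition B_pairs :: "((complex \<Rightarrow> complex) \<times> (complex \<Rightarrow> complex)) set" where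
  "B_pairs = {(a, b). (a, b) \<in> L_pairs \<and>
      Inf ((\<lambda>w. (cmod (Dstar_ext a w))^2) ` {w. 1 < cmod w} \<union> {(cmod (at_infty a))^2}) > 1/2}"

end

theory Submission
  imports Defs "HOL-Complex_Analysis.Complex_Analysis"
begin

text \<open>Put \<open>f = a\<^sup>*\<close> and let \<open>F\<close> be its extension to the disc; the modulus of \<open>f\<close> on the circle
  is prescribed, namely \<open>sqrt (1 - \<bar>b\<bar>\<^sup>2)\<close>.

  Existence: approximate \<open>u = ln (1 - \<bar>b\<bar>\<^sup>2) / 2\<close> boundedly almost everywhere by real parts of polynomials
  \<open>h\<^sub>k\<close> with \<open>h\<^sub>k 0\<close> real. As \<open>\<integral> h\<^sup>2 = 2 pi (h 0)\<^sup>2 \<ge> 0\<close> for such \<open>h\<close>, one has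
  \<open>\<integral> \<bar>h\<bar>\<^sup>2 \<le> 2 \<integral> (Re h)\<^sup>2\<close>, so \<open>h\<^sub>k\<close> is Cauchy in \<open>L\<^sup>2\<close> and a subsequence converges almost
  everywhere; the outer function \<open>f\<close> is the limit of \<open>exp h\<^sub>k\<close>, and the lower bound for \<open>F\<close> follows
  from the maximum principle applied to \<open>- h\<^sub>k\<close>.

  Uniqueness: for two solutions \<open>f\<close>, \<open>g\<close> both \<open>F / G\<close> and \<open>G / F\<close> are bounded and holomorphic. Since
  \<open>F (r z) \<rightarrow> f\<close> in \<open>L\<^sup>2\<close> as \<open>r \<rightarrow> 1\<close>, the mean of the unimodular function \<open>f / g\<close> is
  \<open>Q = F 0 / G 0 > 0\<close> and that of its conjugate \<open>g / f\<close> is \<open>1 / Q\<close>. Hence \<open>Q = 1\<close>, and a unimodular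
  function with mean \<open>1\<close> is \<open>1\<close> almost everywhere.\<close>

section \<open>The Cauchy integral on the circle\<close>

lemma space_circ_meas [simp]: "space circ_meas = {0..2*pi}"
  by (simp add: circ_meas_def)

lemma emeasure_circ_meas: "emeasure circ_meas {0..2*pi} = ennreal (2*pi)"
  by (simp add: circ_meas_def emeasure_restrict_space)

interpretation circ: finite_measure circ_meas
  by standard (simp add: emeasure_circ_meas)

lemma measure_circ_meas [simp]: "measure circ_meas {0..2*pi} = 2*pi"
  by (simp add: measure_def emeasure_circ_meas)

lemma continuous_on_cis_comp:
  "continuous_on (sphere 0 1) g \<Longrightarrow> continuous_on A (\<lambda>t. g (cis t))"
  by (rule continuous_on_compose2[of "sphere 0 1" g]) (auto intro!: continuous_intros)

lemma measurable_cis [measurable]: "cis \<in> borel_measurable circ_meas"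
  unfolding circ_meas_def
  by (intro continuous_imp_measurable_on_sets_lebesgue continuous_intros) auto

lemma measurable_cis_comp_continuous:
  fixes g :: "complex \<Rightarrow> 'a::euclidean_space"
  assumes "continuous_on (sphere 0 1) g"
  shows "(\<lambda>t. g (cis t)) \<in> borel_measurable circ_meas"
  unfolding circ_meas_def
  by (intro continuous_imp_measurable_on_sets_lebesgue continuous_on_cis_comp assms) auto

lemma integrable_cis_comp_continuous:
  fixes g :: "complex \<Rightarrow> 'a::euclidean_space"
  assumes "continuous_on (sphere 0 1) g"
  shows "integrable circ_meas (\<lambda>t. g (cis t))"
  unfolding circ_meas_def
  by (intro continuous_imp_integrable_real continuous_on_cis_comp assms)

lemma one_minus_mult_cis_nonzero: "cmod z < 1 \<Longrightarrow> 1 - z * cis t \<noteq> 0"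
  by (metis eq_iff_diff_eq_0 mult.right_neutral norm_cis norm_mult norm_one order_less_irrefl)

lemma norm_one_minus_mult_cis_ge: "1 - cmod z \<le> cmod (1 - z * cis t)"
  using norm_triangle_ineq2[of 1 "z * cis t"] by (simp add: norm_mult)

text \<open>With \<open>u = cis t\<close> one has \<open>du = \<i> * cis t dt\<close>, so the kernel
  \<open>1 / (u - w)\<close> turns into \<open>1 / (1 - w * cis (-t))\<close>. In this form it
  expands in powers of \<open>w * cis (-t)\<close>, which are the characters in the definition of
  the Fourier coefficients.\<close>

lemma circ_Cauchy_integral:
  fixes g :: "complex \<Rightarrow> complex"
  assumes "continuous_on (cball 0 1) g" "g holomorphic_on ball 0 1" "cmod w < 1"
  shows "(\<integral>t. g (cis t) / (1 - w * cis (-t)) \<partial>circ_meas) = 2 * pi * g w"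
proof -
  have "((\<lambda>u. g u / (u - w)) has_contour_integral (2 * of_real pi * \<i> * g w)) (part_circlepath 0 1 0 (2*pi))"
    using Cauchy_integral_circlepath[of 0 1 g w] assms by (simp add: circlepath_def)
  then have "((\<lambda>t. g (cis t) / (cis t - w) * \<i> * cis t) has_integral (2 * of_real pi * \<i> * g w)) {0..2*pi}"
    by (subst (asm) has_contour_integral_part_circlepath_iff) auto
  then have "((\<lambda>t. - \<i> * (g (cis t) / (cis t - w) * \<i> * cis t)) has_integral - \<i> * (2 * of_real pi * \<i> * g w)) {0..2*pi}"
    by (rule has_integral_mult_right)
  moreover have "- \<i> * (g (cis t) / (cis t - w) * \<i> * cis t) = g (cis t) / (1 - w * cis (-t))" for t
  proof -
    have "cis t - w \<noteq> 0" using assms(3) by (metis eq_iff_diff_eq_0 norm_cis order_less_irrefl)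
    moreover have "cis (-t) * cis t = 1" by (simp add: cis_mult)
    ultimately have "(cis t - w) * (g (cis t)) = (1 - w * cis (-t)) * (g (cis t) * cis t)"
      by (simp add: algebra_simps)
    then show ?thesis using \<open>cis t - w \<noteq> 0\<close> one_minus_mult_cis_nonzero[OF assms(3), of "-t"]
      by (simp add: field_simps)
  qed
  moreover have "- \<i> * (2 * of_real pi * \<i> * g w) = 2 * pi * g w"
    by (metis (no_types, lifting) complex_i_mult_minus minus_mult_left mult.assoc mult.left_commute of_real_mult of_real_numeral minus_minus)
  ultimately have *: "((\<lambda>t. g (cis t) / (1 - w * cis (-t))) has_integral 2 * pi * g w) {0..2*pi}"
    by (simp only:)
  have "continuous_on (sphere 0 1) g"
    using assms(1) by (rule continuous_on_subset) auto
  then have "continuous_on {0..2*pi} (\<lambda>t. g (cis t) / (1 - w * cis (-t)))"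
    by (intro continuous_intros continuous_on_cis_comp)
      (use one_minus_mult_cis_nonzero[OF assms(3)] in auto)
  then have "integrable (lebesgue_on {0..2*pi}) (\<lambda>t. g (cis t) / (1 - w * cis (-t)))"
    by (rule continuous_imp_integrable_real)
  from lebesgue_integral_eq_integral[OF this] * show ?thesis
    by (simp add: circ_meas_def integral_unique)
qed

lemma circ_mean_value:
  fixes g :: "complex \<Rightarrow> complex"
  assumes "continuous_on (cball 0 1) g" "g holomorphic_on ball 0 1"
  shows "(\<integral>t. g (cis t) \<partial>circ_meas) = 2 * pi * g 0"
  using circ_Cauchy_integral[OF assms, of 0] by simp

lemma circ_mean_value_entire:
  fixes g :: "complex \<Rightarrow> complex"
  assumes "g holomorphic_on UNIV"
  shows "(\<integral>t. g (cis t) \<partial>circ_meas) = 2 * pi * g 0"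
  using assms by (intro circ_mean_value)
    (auto intro: holomorphic_on_subset holomorphic_on_imp_continuous_on continuous_on_subset)

section \<open>The extension of a boundary function to the disc\<close>

lemma integrable_mult_bounded:
  fixes f g :: "real \<Rightarrow> complex"
  assumes "integrable circ_meas f" "g \<in> borel_measurable circ_meas"
    "AE t in circ_meas. cmod (g t) \<le> B"
  shows "integrable circ_meas (\<lambda>t. f t * g t)"
proof (rule Bochner_Integration.integrable_bound)
  show "integrable circ_meas (\<lambda>t. B * norm (f t))" using assms(1) by simp
  show "AE t in circ_meas. norm (f t * g t) \<le> norm (B * norm (f t))"
    using assms(3)
  proof eventually_elim
    case (elim t)
    then have "0 \<le> B" using norm_ge_zero order_trans by blast
    then show ?case using elim mult_left_mono[OF elim norm_ge_zero[of "f t"]]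
      by (simp add: norm_mult mult.commute)
  qed
qed (use assms in measurable)

text \<open>Expand the Cauchy kernel as a geometric series in \<open>z * cis (-t)\<close> and
  integrate term by term; the n-th term has norm \<open>cmod (f (cis t)) * cmod z ^ n\<close>, so
  everything converges absolutely. The integral form is the one to which limit theorems for boundary
  functions apply.\<close>

lemma H2_ext_Cauchy_integral:
  assumes f: "integrable circ_meas (\<lambda>t. f (cis t))" and z: "cmod z < 1"
  shows "(\<lambda>n. fourier_coeff f (int n) * z ^ n) sums
      ((\<integral>t. f (cis t) / (1 - z * cis (-t)) \<partial>circ_meas) / complex_of_real (2*pi))"
proof -
  have m [measurable]: "(\<lambda>t. f (cis t)) \<in> borel_measurable circ_meas" using f by auto
  have mc [measurable]: "(\<lambda>t. cis (- (of_int n * t))) \<in> borel_measurable circ_meas" for n :: int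
    unfolding circ_meas_def
    by (intro continuous_imp_measurable_on_sets_lebesgue continuous_intros) auto
  define F where "F = (\<lambda>n t. f (cis t) * cis (- (of_int (int n) * t)) * z ^ n)"
  have I: "integrable circ_meas (F n)" for n
    unfolding F_def by (intro integrable_mult_left integrable_mult_bounded[where B=1] f mc) auto
  have N: "norm (F n t) = cmod (f (cis t)) * cmod z ^ n" for n t
    by (simp add: F_def norm_mult norm_power)
  have S: "summable (\<lambda>n. norm (F n t))" for t
    using z by (simp add: N summable_mult summable_geometric)
  have S': "summable (\<lambda>n. \<integral>t. norm (F n t) \<partial>circ_meas)"
    using z by (simp add: N summable_mult summable_geometric)
  have G: "(\<Sum>n. F n t) = f (cis t) / (1 - z * cis (-t))" for t
  proof -
    have "F n t = f (cis t) * (z * cis (-t)) ^ n" for n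
      using Complex.DeMoivre[of "-t" n] by (simp add: F_def power_mult_distrib)
    moreover have "cmod (z * cis (-t)) < 1" using z by (simp add: norm_mult)
    ultimately show ?thesis using suminf_mult[OF summable_geometric, of "z * cis (-t)" "f (cis t)"]
      by (simp add: suminf_geometric)
  qed
  have "(\<lambda>n. integral\<^sup>L circ_meas (F n)) sums (\<integral>t. (\<Sum>n. F n t) \<partial>circ_meas)"
    by (rule sums_integral) (use I S S' in auto)
  then have "(\<lambda>n. integral\<^sup>L circ_meas (F n) / complex_of_real (2*pi)) sums
     ((\<integral>t. f (cis t) / (1 - z * cis (-t)) \<partial>circ_meas) / complex_of_real (2*pi))"
    unfolding G by (rule sums_divide)
  moreover have "integral\<^sup>L circ_meas (F n) / complex_of_real (2*pi) = fourier_coeff f (int n) * z ^ n" for n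
    by (simp add: F_def fourier_coeff_def)
  ultimately show ?thesis by simp
qed

lemma H2_ext_eq:
  assumes "integrable circ_meas (\<lambda>t. f (cis t))" "cmod z < 1"
  shows "H2_ext f z = (\<integral>t. f (cis t) / (1 - z * cis (-t)) \<partial>circ_meas) / complex_of_real (2*pi)"
  unfolding H2_ext_def using H2_ext_Cauchy_integral[OF assms] by (simp add: sums_iff)

lemma H2_ext_holomorphic:
  assumes "integrable circ_meas (\<lambda>t. f (cis t))"
  shows "H2_ext f holomorphic_on ball 0 1"
proof (rule power_series_holomorphic)
  fix w :: complex assume "w \<in> ball 0 1"
  then show "(\<lambda>n. fourier_coeff f (int n) * (w - 0) ^ n) sums H2_ext f w"
    using H2_ext_Cauchy_integral[OF assms, of w] by (simp add: H2_ext_def sums_iff)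
qed

lemma H2_ext_of_holomorphic:
  fixes g :: "complex \<Rightarrow> complex"
  assumes "continuous_on (cball 0 1) g" "g holomorphic_on ball 0 1" "cmod z < 1"
  shows "H2_ext g z = g z"
proof -
  have "continuous_on (sphere 0 1) g"
    using assms(1) by (rule continuous_on_subset) auto
  then show ?thesis
    using circ_Cauchy_integral[OF assms] H2_ext_eq[OF integrable_cis_comp_continuous assms(3), of g]
    by simp
qed

lemma integrable_div_Cauchy:
  assumes "integrable circ_meas (\<lambda>t. f (cis t))" "cmod z < 1"
  shows "integrable circ_meas (\<lambda>t. f (cis t) / (1 - z * cis (-t)))"
proof -
  have "(\<lambda>t. inverse (1 - z * cis (-t))) \<in> borel_measurable circ_meas"
    unfolding circ_meas_def
    by (intro continuous_imp_measurable_on_sets_lebesgue continuous_intros)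
       (use one_minus_mult_cis_nonzero[OF assms(2)] in auto)
  moreover have "cmod (inverse (1 - z * cis (-t))) \<le> 1 / (1 - cmod z)" for t
    using norm_one_minus_mult_cis_ge[of z "-t"] assms(2)
    by (simp add: norm_inverse divide_inverse le_imp_inverse_le)
  ultimately show ?thesis
    unfolding divide_inverse by (intro integrable_mult_bounded assms(1)) auto
qed

lemma H2_ext_diff:
  assumes "integrable circ_meas (\<lambda>t. f (cis t))" "integrable circ_meas (\<lambda>t. g (cis t))" "cmod z < 1"
  shows "H2_ext (\<lambda>w. f w - g w) z = H2_ext f z - H2_ext g z"
  using assms integrable_div_Cauchy[of f z] integrable_div_Cauchy[of g z]
  by (simp add: H2_ext_eq diff_divide_distrib)

section \<open>Approximation by real parts of polynomials\<close>

text \<open>Strip one coefficient from both polynomials at a time: in the product of the remaining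
  parts the factor \<open>z * cnj z\<close> is 1 on the circle, and a conjugated cross term has the
  same real part as its conjugate. This is what makes real parts of polynomials closed under
  multiplication.\<close>

lemma Re_poly_mult_cnj_poly:
  "\<exists>r. \<forall>z. cmod z = 1 \<longrightarrow> Re (poly p z * cnj (poly q z)) = Re (poly r z)"
proof (induction p q rule: poly_induct2)
  case 0
  show ?case by (rule exI[of _ 0]) simp
next
  case (pCons a p b q)
  then obtain r where r: "\<And>z. cmod z = 1 \<Longrightarrow> Re (poly p z * cnj (poly q z)) = Re (poly r z)" by blast
  define R where "R = [:a * cnj b:] + smult (cnj a) ([:0, 1:] * q) + smult (cnj b) ([:0, 1:] * p) + r"
  have "Re (poly (pCons a p) z * cnj (poly (pCons b q) z)) = Re (poly R z)" if z: "cmod z = 1" for z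
  proof -
    have zz: "z * cnj z = 1" using z by (simp add: complex_norm_square[symmetric])
    have "poly (pCons a p) z * cnj (poly (pCons b q) z) =
       a * cnj b + a * cnj (z * poly q z) + cnj b * (z * poly p z) + (z * cnj z) * (poly p z * cnj (poly q z))"
      by (simp add: algebra_simps)
    also have "Re \<dots> = Re (a * cnj b) + Re (a * cnj (z * poly q z)) + Re (cnj b * (z * poly p z)) + Re (poly r z)"
      unfolding zz using r[OF z] by simp
    also have "Re (a * cnj (z * poly q z)) = Re (cnj a * (z * poly q z))" by (simp add: algebra_simps)
    finally have *: "Re (poly (pCons a p) z * cnj (poly (pCons b q) z)) =
       Re (a * cnj b) + Re (cnj a * (z * poly q z)) + Re (cnj b * (z * poly p z)) + Re (poly r z)" .
    have "poly R z = a * cnj b + cnj a * (z * poly q z) + cnj b * (z * poly p z) + poly r z"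
      by (simp add: R_def algebra_simps)
    then show ?thesis unfolding * by (simp only: plus_complex.sel)
  qed
  then show ?case by blast
qed

lemma real_polynomial_function_eq_Re_poly:
  assumes "real_polynomial_function (g :: complex \<Rightarrow> real)"
  shows "\<exists>h. \<forall>z. cmod z = 1 \<longrightarrow> g z = Re (poly h z)"
  using assms
proof induction
  case (linear f)
  interpret bounded_linear f by fact
  \<comment> \<open>A real linear form on the plane is \<open>Re (c * z)\<close> with
    \<open>c = f 1 - \<i> * f \<i>\<close>.\<close>
  have "f z = Re (poly [:0, Complex (f 1) (- f \<i>):] z)" for z
  proof -
    have "z = Re z *\<^sub>R 1 + Im z *\<^sub>R \<i>" by (simp add: complex_eq_iff)
    then have "f z = Re z * f 1 + Im z * f \<i>" by (metis add scaleR real_scaleR_def)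
    then show ?thesis by (simp add: algebra_simps)
  qed
  then show ?case by blast
next
  case (const c)
  show ?case by (rule exI[of _ "[:of_real c:]"]) simp
next
  case (add f g)
  then obtain p q where "\<And>z. cmod z = 1 \<Longrightarrow> f z = Re (poly p z)" "\<And>z. cmod z = 1 \<Longrightarrow> g z = Re (poly q z)"
    by blast
  then show ?case by (intro exI[of _ "p + q"]) simp
next
  case (mult f g)
  then obtain p q where pq: "\<And>z. cmod z = 1 \<Longrightarrow> f z = Re (poly p z)" "\<And>z. cmod z = 1 \<Longrightarrow> g z = Re (poly q z)"
    by blast
  obtain r where r: "\<And>z. cmod z = 1 \<Longrightarrow> Re (poly p z * cnj (poly q z)) = Re (poly r z)"
    using Re_poly_mult_cnj_poly by blast
  have "f z * g z = Re (poly (smult (1/2) (p * q + r)) z)" if "cmod z = 1" for z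
  proof -
    have "Re x * Re y = (Re (x * y) + Re (x * cnj y)) / 2" for x y by simp
    then show ?thesis using pq[OF that] r[OF that] by simp
  qed
  then show ?case by blast
qed

text \<open>Both endpoints parametrise the point 1, where the continuous approximants built from
  \<open>Arg2pi\<close> are forced to be 0; they are therefore put into the null set.\<close>

lemma AE_circ_meas_negligible:
  assumes "negligible N" "\<And>t. t \<in> {0<..<2*pi} \<Longrightarrow> t \<notin> N \<Longrightarrow> P t"
  shows "AE t in circ_meas. P t"
proof -
  have "N \<union> {0, 2*pi} \<in> null_sets lebesgue"
    using assms(1) by (simp add: negligible_iff_null_sets[symmetric])
  then have "AE t in lebesgue. t \<notin> N \<union> {0, 2*pi}" by (rule AE_not_in)
  then have "AE t in lebesgue. t \<in> {0..2*pi} \<longrightarrow> P t"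
  proof eventually_elim
    case (elim t)
    then show ?case using assms(2)[of t] by auto
  qed
  then show ?thesis unfolding circ_meas_def by (subst AE_restrict_space_iff) auto
qed

text \<open>The factor \<open>min 1 (k * cmod (z - 1))\<close> removes the jump of \<open>Arg2pi\<close> at \<open>1\<close>.\<close>

lemma AE_limit_continuous_on_circle:
  fixes u :: "real \<Rightarrow> real"
  assumes u: "u \<in> borel_measurable circ_meas"
    and m: "\<And>t. m \<le> u t" "\<And>t. u t \<le> M" "m \<le> 0" "0 \<le> M"
  obtains G :: "nat \<Rightarrow> complex \<Rightarrow> real"
  where "\<And>k. continuous_on (sphere 0 1) (G k)" "\<And>k z. m \<le> G k z" "\<And>k z. G k z \<le> M"
    "AE t in circ_meas. (\<lambda>k. G k (cis t)) \<longlonglongrightarrow> u t"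
proof -
  have "u measurable_on {0..2*pi}"
    using u by (simp add: circ_meas_def measurable_on_iff_borel_measurable)
  \<comment> \<open>Measurability in the form used here: off a null set the function, extended by 0,
    is a pointwise limit of continuous functions on the line.\<close>
  then obtain N g where N: "negligible N" and g: "\<And>n. continuous_on UNIV (g n)"
    and lim: "\<And>x. x \<notin> N \<Longrightarrow> (\<lambda>n. g n x) \<longlonglongrightarrow> (if x \<in> {0..2*pi} then u x else 0)"
    unfolding measurable_on_def by blast
  \<comment> \<open>Clipping enforces the bounds and does not disturb the limit, because
    \<open>u\<close> has its values in the same interval. As \<open>m \<le> 0 \<le> M\<close>,
    multiplying by a factor between 0 and 1 keeps the bounds.\<close>
  define c where "c = (\<lambda>k (x::real). max m (min M (g k x)))"
  define \<phi> where "\<phi> = (\<lambda>k (z::complex). min 1 (real k * cmod (z - 1)))"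
  define G where "G = (\<lambda>k z. c k (Arg2pi z) * \<phi> k z)"
  have c: "m \<le> c k x" "c k x \<le> M" for k x using m by (auto simp: c_def)
  have \<phi>: "0 \<le> \<phi> k z" "\<phi> k z \<le> 1" for k z by (auto simp: \<phi>_def)
  have cont_c: "isCont (c k) x" for k x
  proof -
    have "continuous_on UNIV (c k)" unfolding c_def by (intro continuous_intros g)
    then show ?thesis by (simp add: continuous_on_eq_continuous_at)
  qed
  have cont_\<phi>: "isCont (\<phi> k) z" for k z unfolding \<phi>_def by (intro continuous_intros)
  show ?thesis
  proof (rule that)
    fix k z
    have "m * 1 \<le> m * \<phi> k z" using \<phi>[of k z] m by (intro mult_left_mono_neg) auto
    also have "\<dots> \<le> c k (Arg2pi z) * \<phi> k z" using c \<phi> by (intro mult_right_mono) auto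
    finally show "m \<le> G k z" by (simp add: G_def)
    have "c k (Arg2pi z) * \<phi> k z \<le> M * \<phi> k z" using c \<phi> by (intro mult_right_mono) auto
    also have "\<dots> \<le> M * 1" using \<phi>[of k z] m by (intro mult_left_mono) auto
    finally show "G k z \<le> M" by (simp add: G_def)
  next
    fix k
    show "continuous_on (sphere 0 1) (G k)"
    proof (rule continuous_at_imp_continuous_on, rule ballI)
      fix z :: complex assume z: "z \<in> sphere 0 1"
      show "isCont (G k) z"
      proof (cases "z = 1")
        case True
        have "((\<lambda>x. G k x) \<longlongrightarrow> 0) (at 1)"
        proof (rule Lim_null_comparison)
          have "norm (G k x) \<le> max \<bar>m\<bar> \<bar>M\<bar> * \<phi> k x" for x
          proof -
            have "\<bar>c k (Arg2pi x)\<bar> \<le> max \<bar>m\<bar> \<bar>M\<bar>" using c[of k "Arg2pi x"] by linarith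
            then show ?thesis using \<phi>[of k x] by (simp add: G_def abs_mult mult_right_mono)
          qed
          then show "\<forall>\<^sub>F x in at 1. norm (G k x) \<le> max \<bar>m\<bar> \<bar>M\<bar> * \<phi> k x" by simp
          have "(\<phi> k \<longlongrightarrow> \<phi> k 1) (at 1)" using cont_\<phi> by (simp add: isCont_def)
          then have "((\<lambda>x. max \<bar>m\<bar> \<bar>M\<bar> * \<phi> k x) \<longlongrightarrow> max \<bar>m\<bar> \<bar>M\<bar> * \<phi> k 1) (at 1)"
            by (rule tendsto_mult_left)
          then show "((\<lambda>x. max \<bar>m\<bar> \<bar>M\<bar> * \<phi> k x) \<longlongrightarrow> 0) (at 1)" by (simp add: \<phi>_def)
        qed
        moreover have "G k 1 = 0" by (simp add: G_def \<phi>_def)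
        ultimately show ?thesis using True by (simp add: isCont_def)
      next
        case False
        have "z \<notin> \<real>\<^sub>\<ge>\<^sub>0"
          using z False by (auto simp: nonneg_Reals_def)
        then have "isCont Arg2pi z" by (rule continuous_at_Arg2pi)
        then have "isCont (\<lambda>x. c k (Arg2pi x)) z" by (rule isCont_o2[OF _ cont_c])
        then show ?thesis unfolding G_def by (rule isCont_mult[OF _ cont_\<phi>])
      qed
    qed
  next
    show "AE t in circ_meas. (\<lambda>k. G k (cis t)) \<longlonglongrightarrow> u t"
    proof (rule AE_circ_meas_negligible[OF N])
      fix t assume t: "t \<in> {0<..<2*pi}" "t \<notin> N"
      have A: "Arg2pi (cis t) = t"
        by (rule Arg2pi_unique[of 1]) (use t in \<open>auto simp: cis_conv_exp\<close>)
      have "(\<lambda>k. c k t) \<longlonglongrightarrow> max m (min M (u t))"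
        unfolding c_def using lim[OF t(2)] t(1) by (intro tendsto_intros) auto
      then have 1: "(\<lambda>k. c k t) \<longlonglongrightarrow> u t" using m(1,2)[of t] by (simp only: max.absorb2 min.absorb2)
      have "cis t \<noteq> 1"
        using A t Arg2pi_unique[of 1 0 1] by auto
      then have pos: "cmod (cis t - 1) > 0" by simp
      \<comment> \<open>For fixed \<open>t\<close> the factor \<open>\<phi> k (cis t)\<close> is 1
        from some \<open>k\<close> on, so \<open>G k (cis t)\<close> eventually agrees with the
        clipped approximant.\<close>
      have "filterlim (\<lambda>k. real k * cmod (cis t - 1)) at_top sequentially"
        using filterlim_at_top_mult_tendsto_pos[OF tendsto_const pos filterlim_real_sequentially]
        by (simp add: mult.commute)
      then have "\<forall>\<^sub>F k in sequentially. 1 \<le> real k * cmod (cis t - 1)"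
        by (simp add: filterlim_at_top)
      then have "\<forall>\<^sub>F k in sequentially. c k t = G k (cis t)"
        by eventually_elim (simp add: G_def \<phi>_def A)
      then show "(\<lambda>k. G k (cis t)) \<longlonglongrightarrow> u t" using 1 by (rule Lim_transform_eventually[rotated])
    qed
  qed
qed

text \<open>Stone-Weierstrass replaces the k-th continuous approximant, uniformly within
  \<open>1 / Suc k\<close>, by the real part of a polynomial. The bounds widen by the same amount,
  and the limit stays.\<close>

lemma AE_limit_Re_poly:
  fixes u :: "real \<Rightarrow> real"
  assumes u: "u \<in> borel_measurable circ_meas"
    and m: "\<And>t. m \<le> u t" "\<And>t. u t \<le> M" "m \<le> 0" "0 \<le> M"
  obtains h :: "nat \<Rightarrow> complex poly"
  where "\<And>k. Im (poly (h k) 0) = 0"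
    "\<And>k z. cmod z = 1 \<Longrightarrow> m - 1 / real (Suc k) \<le> Re (poly (h k) z)"
    "\<And>k z. cmod z = 1 \<Longrightarrow> Re (poly (h k) z) \<le> M + 1 / real (Suc k)"
    "AE t in circ_meas. (\<lambda>k. Re (poly (h k) (cis t))) \<longlonglongrightarrow> u t"
proof -
  obtain G :: "nat \<Rightarrow> complex \<Rightarrow> real" where
    G: "\<And>k. continuous_on (sphere 0 1) (G k)" "\<And>k z. m \<le> G k z" "\<And>k z. G k z \<le> M"
    "AE t in circ_meas. (\<lambda>k. G k (cis t)) \<longlonglongrightarrow> u t"
    using AE_limit_continuous_on_circle[OF assms] by blast
  have "\<exists>h. Im (poly h 0) = 0 \<and> (\<forall>z. cmod z = 1 \<longrightarrow> \<bar>G k z - Re (poly h z)\<bar> < 1 / real (Suc k))" for k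
  proof -
    have "0 < 1 / real (Suc k)" by simp
    from Stone_Weierstrass_real_polynomial_function[OF compact_sphere G(1) this]
    obtain g where g: "real_polynomial_function g" "\<And>z. z \<in> sphere 0 1 \<Longrightarrow> \<bar>G k z - g z\<bar> < 1 / real (Suc k)"
      by blast
    obtain h where h: "\<And>z. cmod z = 1 \<Longrightarrow> g z = Re (poly h z)"
      using real_polynomial_function_eq_Re_poly[OF g(1)] by blast
    \<comment> \<open>Subtracting an imaginary constant leaves the real part alone and makes the
      value at 0 real.\<close>
    define h' where "h' = h - [:\<i> * Im (poly h 0):]"
    have "Im (poly h' 0) = 0" "Re (poly h' z) = Re (poly h z)" for z by (auto simp: h'_def)
    then show ?thesis using g(2) h by (intro exI[of _ h']) auto
  qed
  then obtain h where h: "\<And>k. Im (poly (h k) 0) = 0"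
    "\<And>k z. cmod z = 1 \<Longrightarrow> \<bar>G k z - Re (poly (h k) z)\<bar> < 1 / real (Suc k)" by metis
  show ?thesis
  proof (rule that)
    show "Im (poly (h k) 0) = 0" for k by (rule h)
    show "m - 1 / real (Suc k) \<le> Re (poly (h k) z)" "Re (poly (h k) z) \<le> M + 1 / real (Suc k)"
      if "cmod z = 1" for k z
      using h(2)[OF that, of k] G(2)[of k z] G(3)[of k z] by linarith+
    show "AE t in circ_meas. (\<lambda>k. Re (poly (h k) (cis t))) \<longlonglongrightarrow> u t"
      using G(4)
    proof eventually_elim
      case (elim t)
      have "(\<lambda>k. G k (cis t) - Re (poly (h k) (cis t))) \<longlonglongrightarrow> 0"
      proof (rule Lim_null_comparison)
        show "\<forall>\<^sub>F k in sequentially. norm (G k (cis t) - Re (poly (h k) (cis t))) \<le> 1 / real (Suc k)"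
          using h(2)[of "cis t"] by (simp add: less_imp_le)
        show "(\<lambda>k. 1 / real (Suc k)) \<longlonglongrightarrow> 0" by (rule LIMSEQ_Suc) (rule lim_1_over_n)
      qed
      from tendsto_diff[OF elim this] show ?case by simp
    qed
  qed
qed

text \<open>This controls the harmonic conjugate by the real part. In
  \<open>\<bar>z\<bar>\<^sup>2 = 2 (Re z)\<^sup>2 - Re (z\<^sup>2)\<close> the last term integrates
  to the nonnegative number \<open>2 * pi * (poly p 0)\<^sup>2\<close> and is dropped.\<close>

lemma integral_cmod_poly_sq_le:
  assumes "Im (poly p 0) = 0"
  shows "(\<integral>t. (cmod (poly p (cis t)))\<^sup>2 \<partial>circ_meas) \<le> 2 * (\<integral>t. (Re (poly p (cis t)))\<^sup>2 \<partial>circ_meas)"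
proof -
  have i1: "integrable circ_meas (\<lambda>t. (poly p (cis t))\<^sup>2)"
    and i2: "integrable circ_meas (\<lambda>t. (Re (poly p (cis t)))\<^sup>2)"
    by (rule integrable_cis_comp_continuous; intro continuous_intros)+
  have "(cmod z)\<^sup>2 = 2 * (Re z)\<^sup>2 - Re (z\<^sup>2)" for z
    by (simp add: cmod_power2 Re_power2)
  then have "(\<integral>t. (cmod (poly p (cis t)))\<^sup>2 \<partial>circ_meas)
     = 2 * (\<integral>t. (Re (poly p (cis t)))\<^sup>2 \<partial>circ_meas) - Re (\<integral>t. (poly p (cis t))\<^sup>2 \<partial>circ_meas)"
    using i1 i2 by (simp flip: integral_Re)
  moreover have "(\<integral>t. (poly p (cis t))\<^sup>2 \<partial>circ_meas) = 2 * pi * (poly p 0)\<^sup>2"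
    by (rule circ_mean_value_entire) (intro holomorphic_intros)
  moreover have "0 \<le> Re (2 * pi * (poly p 0)\<^sup>2)" using assms by (simp add: power2_eq_square)
  ultimately show ?thesis by simp
qed

text \<open>The Riesz-Fischer argument: along a subsequence with rapidly decreasing squared
  distances, a weighted sum of the squared increments has finite integral. It is then finite almost
  everywhere, which forces the increments themselves to be absolutely summable.\<close>

lemma L2_Cauchy_imp_AE_convergent_subseq:
  fixes g :: "nat \<Rightarrow> 'a \<Rightarrow> complex"
  assumes m [measurable]: "\<And>k. g k \<in> borel_measurable M"
    and int: "\<And>k l. integrable M (\<lambda>t. (cmod (g k t - g l t))\<^sup>2)"
    and cauchy: "\<And>e. 0 < e \<Longrightarrow> \<exists>N. \<forall>k\<ge>N. \<forall>l\<ge>N. (\<integral>t. (cmod (g k t - g l t))\<^sup>2 \<partial>M) < e"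
  shows "\<exists>\<sigma>. strict_mono \<sigma> \<and> (AE t in M. convergent (\<lambda>j. g (\<sigma> j) t))"
proof -
  have "\<exists>N. \<forall>k\<ge>N. \<forall>l\<ge>N. (\<integral>t. (cmod (g k t - g l t))\<^sup>2 \<partial>M) < (1/4)^j" for j :: nat
    by (rule cauchy) simp
  then obtain N where N: "\<And>j k l. N j \<le> k \<Longrightarrow> N j \<le> l \<Longrightarrow> (\<integral>t. (cmod (g k t - g l t))\<^sup>2 \<partial>M) < (1/4)^j"
    by metis
  \<comment> \<open>The sum dominates \<open>N j\<close>, and the extra \<open>j\<close> makes the
    sequence strictly increasing.\<close>
  define \<sigma> where "\<sigma> = (\<lambda>j. (\<Sum>i\<le>j. N i) + j)"
  have mono: "strict_mono \<sigma>" by (simp add: strict_mono_Suc_iff \<sigma>_def)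
  have ge: "N j \<le> \<sigma> j" for j
    unfolding \<sigma>_def by (rule trans_le_add1, rule member_le_sum) auto
  define d where "d = (\<lambda>j t. g (\<sigma> (Suc j)) t - g (\<sigma> j) t)"
  have d_int: "(\<integral>t. (cmod (d j t))\<^sup>2 \<partial>M) \<le> (1/4)^j" for j
  proof -
    have "\<sigma> j \<le> \<sigma> (Suc j)" by (simp add: \<sigma>_def)
    then show ?thesis
      unfolding d_def using N[of j "\<sigma> (Suc j)" "\<sigma> j"] ge[of j] by linarith
  qed
  \<comment> \<open>The weight \<open>sqrt 2 ^ j\<close> is small enough for
    \<open>(sqrt 2 / 4) ^ j\<close> to be summable and large enough for its reciprocal to be
    summable as well.\<close>
  define f where "f = (\<lambda>j t. sqrt 2 ^ j * (cmod (d j t))\<^sup>2)"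
  have [measurable]: "f j \<in> borel_measurable M" for j unfolding f_def d_def by measurable
  have nn: "0 \<le> f j t" for j t by (simp add: f_def)
  have sqrt2: "sqrt 2 / 4 < (1::real)" using sqrt2_less_2 by linarith
  have "(\<integral>\<^sup>+t. ennreal (f j t) \<partial>M) \<le> ennreal ((sqrt 2 / 4) ^ j)" for j
  proof -
    have "integrable M (f j)" unfolding f_def d_def by (intro integrable_mult_right int)
    then have "(\<integral>\<^sup>+t. ennreal (f j t) \<partial>M) = ennreal (integral\<^sup>L M (f j))"
      by (rule nn_integral_eq_integral) (simp add: nn)
    also have "integral\<^sup>L M (f j) = sqrt 2 ^ j * (\<integral>t. (cmod (d j t))\<^sup>2 \<partial>M)" by (simp add: f_def)
    also have "\<dots> \<le> sqrt 2 ^ j * (1/4)^j" by (intro mult_left_mono d_int) simp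
    also have "\<dots> = (sqrt 2 / 4) ^ j" by (simp add: power_divide)
    finally show ?thesis by (simp add: ennreal_leI)
  qed
  then have "(\<Sum>j. \<integral>\<^sup>+t. ennreal (f j t) \<partial>M) \<le> (\<Sum>j. ennreal ((sqrt 2 / 4) ^ j))"
    by (intro suminf_le) auto
  also have "\<dots> = ennreal (\<Sum>j. (sqrt 2 / 4) ^ j)"
    using sqrt2 by (intro suminf_ennreal2 summable_geometric) auto
  also have "\<dots> < \<infinity>" by simp
  finally have "(\<integral>\<^sup>+t. (\<Sum>j. ennreal (f j t)) \<partial>M) \<noteq> \<infinity>"
    by (subst nn_integral_suminf) auto
  then have "AE t in M. (\<Sum>j. ennreal (f j t)) \<noteq> \<infinity>"
    by (intro nn_integral_noteq_infinite) auto
  then have "AE t in M. convergent (\<lambda>j. g (\<sigma> j) t)"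
  proof eventually_elim
    case (elim t)
    then have s: "summable (\<lambda>j. f j t)" by (intro summable_suminf_not_top nn) auto
    text \<open>\<open>x \<le> c + x\<^sup>2 / c\<close> with \<open>c = (1 / sqrt 2) ^ j\<close>\<close>
    have le: "norm (d j t) \<le> (1 / sqrt 2) ^ j + f j t" for j
    proof (cases "cmod (d j t) \<le> (1 / sqrt 2) ^ j")
      case True
      then show ?thesis using nn[of j t] by simp
    next
      case False
      then have "1 \<le> sqrt 2 ^ j * cmod (d j t)" by (simp add: power_divide field_simps)
      then have "cmod (d j t) * 1 \<le> cmod (d j t) * (sqrt 2 ^ j * cmod (d j t))"
        by (intro mult_left_mono) auto
      also have "\<dots> = f j t" by (simp add: f_def power2_eq_square)
      finally show ?thesis by (simp add: add_increasing)
    qed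
    have "summable (\<lambda>j. (1 / sqrt 2) ^ j + f j t)"
      by (intro summable_add summable_geometric s) auto
    then have "summable (\<lambda>j. d j t)" 
      by (rule summable_comparison_test'[where N = 0]) (rule le)
    then have "convergent (\<lambda>n. \<Sum>j<n. d j t)" by (simp add: summable_iff_convergent)
    then have "convergent (\<lambda>n. g (\<sigma> n) t - g (\<sigma> 0) t)"
      unfolding d_def sum_lessThan_telescope[of "\<lambda>j. g (\<sigma> j) t"] .
    then have "convergent (\<lambda>n. (g (\<sigma> n) t - g (\<sigma> 0) t) + g (\<sigma> 0) t)"
      by (intro convergent_add convergent_const)
    then show ?case by simp
  qed
  then show ?thesis using mono by blast
qed

text \<open>The approximants are uniformly bounded and the measure is finite, so dominated
  convergence turns almost everywhere convergence into mean-square convergence. The majorant uses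
  that the excess \<open>1 / Suc k\<close> is at most 1.\<close>

lemma L2_limit_Re_poly:
  fixes u :: "real \<Rightarrow> real"
  assumes u [measurable]: "u \<in> borel_measurable circ_meas"
    and m: "\<And>t. m \<le> u t" "\<And>t. u t \<le> M" "m \<le> 0" "0 \<le> M"
  obtains h :: "nat \<Rightarrow> complex poly"
  where "\<And>k. Im (poly (h k) 0) = 0"
    "\<And>k z. cmod z = 1 \<Longrightarrow> m - 1 / real (Suc k) \<le> Re (poly (h k) z)"
    "\<And>k z. cmod z = 1 \<Longrightarrow> Re (poly (h k) z) \<le> M + 1 / real (Suc k)"
    "AE t in circ_meas. (\<lambda>k. Re (poly (h k) (cis t))) \<longlonglongrightarrow> u t"
    "(\<lambda>k. \<integral>t. (Re (poly (h k) (cis t)) - u t)\<^sup>2 \<partial>circ_meas) \<longlonglongrightarrow> 0"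
    "\<And>k. integrable circ_meas (\<lambda>t. (Re (poly (h k) (cis t)) - u t)\<^sup>2)"
proof -
  obtain h :: "nat \<Rightarrow> complex poly" where h: "\<And>k. Im (poly (h k) 0) = 0"
    "\<And>k z. cmod z = 1 \<Longrightarrow> m - 1 / real (Suc k) \<le> Re (poly (h k) z)"
    "\<And>k z. cmod z = 1 \<Longrightarrow> Re (poly (h k) z) \<le> M + 1 / real (Suc k)"
    "AE t in circ_meas. (\<lambda>k. Re (poly (h k) (cis t))) \<longlonglongrightarrow> u t"
    using AE_limit_Re_poly[OF assms] by blast
  have [measurable]: "(\<lambda>t. Re (poly (h k) (cis t))) \<in> borel_measurable circ_meas" for k
    by (intro measurable_cis_comp_continuous continuous_intros)
  have bd: "norm ((Re (poly (h k) (cis t)) - u t)\<^sup>2) \<le> (M - m + 1)\<^sup>2" for k t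
  proof -
    have "1 / real (Suc k) \<le> 1" by simp
    then have "\<bar>Re (poly (h k) (cis t)) - u t\<bar> \<le> \<bar>M - m + 1\<bar>"
      using h(2)[of "cis t" k] h(3)[of "cis t" k] m(1)[of t] m(2)[of t] m(3,4)
      by (simp only: norm_cis) linarith
    then show ?thesis by (simp add: abs_le_square_iff)
  qed
  have lim: "AE t in circ_meas. (\<lambda>k. (Re (poly (h k) (cis t)) - u t)\<^sup>2) \<longlonglongrightarrow> 0"
    using h(4)
  proof eventually_elim
    case (elim t)
    then have "(\<lambda>k. (Re (poly (h k) (cis t)) - u t)\<^sup>2) \<longlonglongrightarrow> (u t - u t)\<^sup>2"
      by (intro tendsto_intros)
    then show ?case by simp
  qed
  show ?thesis
  proof (rule that[OF h])
    show "integrable circ_meas (\<lambda>t. (Re (poly (h k) (cis t)) - u t)\<^sup>2)" for k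
      by (rule circ.integrable_const_bound[OF AE_I2[OF bd]]) measurable
    have "(\<lambda>k. \<integral>t. (Re (poly (h k) (cis t)) - u t)\<^sup>2 \<partial>circ_meas) \<longlonglongrightarrow> (\<integral>t. 0 \<partial>circ_meas)"
      by (rule integral_dominated_convergence[where w = "\<lambda>_. (M - m + 1)\<^sup>2", OF _ _ _ lim AE_I2[OF bd]]) auto
    then show "(\<lambda>k. \<integral>t. (Re (poly (h k) (cis t)) - u t)\<^sup>2 \<partial>circ_meas) \<longlonglongrightarrow> 0" by simp
  qed auto
qed

text \<open>The difference \<open>h k - h l\<close> is again real at 0, so the mean-square Cauchy
  property of the real parts passes to the polynomials themselves.\<close>

lemma AE_convergent_poly_subseq:
  fixes u :: "real \<Rightarrow> real" and h :: "nat \<Rightarrow> complex poly"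
  assumes h0: "\<And>k. Im (poly (h k) 0) = 0"
    and lim: "(\<lambda>k. \<integral>t. (Re (poly (h k) (cis t)) - u t)\<^sup>2 \<partial>circ_meas) \<longlonglongrightarrow> 0"
    and int: "\<And>k. integrable circ_meas (\<lambda>t. (Re (poly (h k) (cis t)) - u t)\<^sup>2)"
  shows "\<exists>\<sigma>. strict_mono \<sigma> \<and> (AE t in circ_meas. convergent (\<lambda>j. poly (h (\<sigma> j)) (cis t)))"
proof (rule L2_Cauchy_imp_AE_convergent_subseq)
  show "(\<lambda>t. poly (h k) (cis t)) \<in> borel_measurable circ_meas" for k
    by (intro measurable_cis_comp_continuous continuous_intros)
  show "integrable circ_meas (\<lambda>t. (cmod (poly (h k) (cis t) - poly (h l) (cis t)))\<^sup>2)" for k l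
    by (rule integrable_cis_comp_continuous) (intro continuous_intros)
  fix e :: real assume "0 < e"
  \<comment> \<open>The two estimates below cost \<open>2 * (2 * e/8 + 2 * e/8) = e\<close>.\<close>
  then obtain N where N: "\<And>k. N \<le> k \<Longrightarrow> (\<integral>t. (Re (poly (h k) (cis t)) - u t)\<^sup>2 \<partial>circ_meas) < e / 8"
    using order_tendstoD(2)[OF lim, of "e/8"] by (auto simp: eventually_sequentially)
  have "(\<integral>t. (cmod (poly (h k) (cis t) - poly (h l) (cis t)))\<^sup>2 \<partial>circ_meas) < e"
    if kl: "N \<le> k" "N \<le> l" for k l
  proof -
    have sq: "(a - b)\<^sup>2 \<le> 2 * (a - c)\<^sup>2 + 2 * (b - c)\<^sup>2" for a b c :: real
      using zero_le_power2[of "a + b - 2 * c"] by (simp add: power2_eq_square algebra_simps)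
    have "(\<integral>t. (cmod (poly (h k - h l) (cis t)))\<^sup>2 \<partial>circ_meas)
      \<le> 2 * (\<integral>t. (Re (poly (h k - h l) (cis t)))\<^sup>2 \<partial>circ_meas)"
      by (rule integral_cmod_poly_sq_le) (simp add: h0)
    moreover have "(\<integral>t. (Re (poly (h k - h l) (cis t)))\<^sup>2 \<partial>circ_meas)
      \<le> (\<integral>t. 2 * (Re (poly (h k) (cis t)) - u t)\<^sup>2 + 2 * (Re (poly (h l) (cis t)) - u t)\<^sup>2 \<partial>circ_meas)"
    proof (rule integral_mono)
      show "integrable circ_meas (\<lambda>t. (Re (poly (h k - h l) (cis t)))\<^sup>2)"
        by (rule integrable_cis_comp_continuous) (intro continuous_intros)
      show "(Re (poly (h k - h l) (cis t)))\<^sup>2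
          \<le> 2 * (Re (poly (h k) (cis t)) - u t)\<^sup>2 + 2 * (Re (poly (h l) (cis t)) - u t)\<^sup>2" for t
        using sq by simp
    qed (use int in auto)
    moreover have "(\<integral>t. 2 * (Re (poly (h k) (cis t)) - u t)\<^sup>2 + 2 * (Re (poly (h l) (cis t)) - u t)\<^sup>2 \<partial>circ_meas)
      = 2 * (\<integral>t. (Re (poly (h k) (cis t)) - u t)\<^sup>2 \<partial>circ_meas)
        + 2 * (\<integral>t. (Re (poly (h l) (cis t)) - u t)\<^sup>2 \<partial>circ_meas)"
      using int by simp
    ultimately show ?thesis using N[OF kl(1)] N[OF kl(2)] \<open>0 < e\<close> by simp
  qed
  then show "\<exists>N. \<forall>k\<ge>N. \<forall>l\<ge>N.
      (\<integral>t. (cmod (poly (h k) (cis t) - poly (h l) (cis t)))\<^sup>2 \<partial>circ_meas) < e" by blast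
qed

section \<open>Existence\<close>

lemma L2T_of_bounded:
  assumes "T_measurable f" "AE t in circ_meas. cmod (f (cis t)) \<le> B"
  shows "L2T f"
proof -
  have [measurable]: "(\<lambda>t. f (cis t)) \<in> borel_measurable circ_meas"
    using assms(1) by (simp add: T_measurable_def)
  have "AE t in circ_meas. norm ((cmod (f (cis t)))\<^sup>2) \<le> B\<^sup>2"
    using assms(2) by eventually_elim (simp add: power_mono)
  then have "integrable circ_meas (\<lambda>t. (cmod (f (cis t)))\<^sup>2)"
    by (rule circ.integrable_const_bound) measurable
  then show ?thesis using assms(1) by (simp add: L2T_def)
qed

lemma Re_poly_ge_on_disc:
  assumes "\<And>z. cmod z = 1 \<Longrightarrow> B \<le> Re (poly p z)" "cmod z < 1"
  shows "B \<le> Re (poly p z)"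
proof -
  have "Re (- poly p z) \<le> - B"
    by (rule maximum_real_frontier[of _ "ball 0 1"])
      (use assms in \<open>auto intro!: holomorphic_intros continuous_intros\<close>)
  then show ?thesis by simp
qed

lemma tendsto_integral_mult_bounded:
  fixes g :: "nat \<Rightarrow> real \<Rightarrow> complex"
  assumes [measurable]: "\<And>j. g j \<in> borel_measurable circ_meas" "f \<in> borel_measurable circ_meas"
      "w \<in> borel_measurable circ_meas"
    and lim: "AE t in circ_meas. (\<lambda>j. g j t) \<longlonglongrightarrow> f t"
    and bd: "\<And>j t. cmod (g j t) \<le> B" "\<And>t. cmod (w t) \<le> C"
  shows "(\<lambda>j. \<integral>t. g j t * w t \<partial>circ_meas) \<longlonglongrightarrow> (\<integral>t. f t * w t \<partial>circ_meas)"
proof (rule integral_dominated_convergence[where w = "\<lambda>_. B * C"])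
  have "0 \<le> B" using bd(1) norm_ge_zero order_trans by blast
  then show "AE t in circ_meas. norm (g j t * w t) \<le> B * C" for j
    using bd by (simp add: norm_mult mult_mono)
  show "AE t in circ_meas. (\<lambda>j. g j t * w t) \<longlonglongrightarrow> f t * w t"
    using lim by eventually_elim (intro tendsto_intros)
qed auto

lemma outer_function_exists:
  fixes u :: "real \<Rightarrow> real"
  assumes u: "u \<in> borel_measurable circ_meas" and m: "\<And>t. m \<le> u t" "\<And>t. u t \<le> 0"
  obtains f :: "complex \<Rightarrow> complex"
  where "H2_D f" "AE t in circ_meas. cmod (f (cis t)) = exp (u t)"
    "\<And>z. cmod z < 1 \<Longrightarrow> exp m \<le> cmod (H2_ext f z)"
    "Im (H2_ext f 0) = 0" "0 < Re (H2_ext f 0)"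
proof -
  have m0: "m \<le> 0" using m[of 0] by simp
  obtain h :: "nat \<Rightarrow> complex poly" where h: "\<And>k. Im (poly (h k) 0) = 0"
    "\<And>k z. cmod z = 1 \<Longrightarrow> m - 1 / real (Suc k) \<le> Re (poly (h k) z)"
    "\<And>k z. cmod z = 1 \<Longrightarrow> Re (poly (h k) z) \<le> 0 + 1 / real (Suc k)"
    "AE t in circ_meas. (\<lambda>k. Re (poly (h k) (cis t))) \<longlonglongrightarrow> u t"
    "(\<lambda>k. \<integral>t. (Re (poly (h k) (cis t)) - u t)\<^sup>2 \<partial>circ_meas) \<longlonglongrightarrow> 0"
    "\<And>k. integrable circ_meas (\<lambda>t. (Re (poly (h k) (cis t)) - u t)\<^sup>2)"
    using L2_limit_Re_poly[OF u m m0 order_refl] by blast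
  obtain \<sigma> where \<sigma>: "strict_mono \<sigma>" "AE t in circ_meas. convergent (\<lambda>j. poly (h (\<sigma> j)) (cis t))"
    using AE_convergent_poly_subseq[OF h(1,5,6)] by blast
  define E where "E = (\<lambda>j z. exp (poly (h (\<sigma> j)) z))"
  \<comment> \<open>Where the sequence diverges, \<open>lim\<close> is an unspecified value; on the
    circle this happens only on a null set.\<close>
  define f where "f = (\<lambda>z. lim (\<lambda>j. E j z))"
  have E_meas [measurable]: "(\<lambda>t. E j (cis t)) \<in> borel_measurable circ_meas" for j
    unfolding E_def by (intro measurable_cis_comp_continuous continuous_intros)
  have E_hol: "E j holomorphic_on A" for j A unfolding E_def by (intro holomorphic_intros)
  have E_bd: "cmod (E j (cis t)) \<le> exp 1" for j t
  proof -
    have "Re (poly (h (\<sigma> j)) (cis t)) \<le> 1 / real (Suc (\<sigma> j))" using h(3)[of "cis t" "\<sigma> j"] by simp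
    also have "\<dots> \<le> 1" by simp
    finally show ?thesis by (simp add: E_def)
  qed
  have f_meas [measurable]: "(\<lambda>t. f (cis t)) \<in> borel_measurable circ_meas"
    unfolding f_def by (rule borel_measurable_lim_metric) (rule E_meas)
  have E_lim: "AE t in circ_meas. (\<lambda>j. E j (cis t)) \<longlonglongrightarrow> f (cis t)"
    using \<sigma>(2)
  proof eventually_elim
    case (elim t)
    then obtain l where "(\<lambda>j. poly (h (\<sigma> j)) (cis t)) \<longlonglongrightarrow> l" by (auto simp: convergent_def)
    then have "(\<lambda>j. E j (cis t)) \<longlonglongrightarrow> exp l" unfolding E_def by (rule tendsto_exp)
    then show ?case unfolding f_def by (simp add: limI)
  qed
  have f_abs: "AE t in circ_meas. cmod (f (cis t)) = exp (u t)"
    using E_lim h(4)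
  proof eventually_elim
    case (elim t)
    have "(\<lambda>j. Re (poly (h (\<sigma> j)) (cis t))) \<longlonglongrightarrow> u t"
      using LIMSEQ_subseq_LIMSEQ[OF elim(2) \<sigma>(1)] by (simp add: o_def)
    then have "(\<lambda>j. cmod (E j (cis t))) \<longlonglongrightarrow> exp (u t)"
      unfolding E_def norm_exp_eq_Re by (rule tendsto_exp)
    then show ?case using tendsto_norm[OF elim(1)] LIMSEQ_unique by blast
  qed
  have f_bd: "AE t in circ_meas. cmod (f (cis t)) \<le> 1"
    using f_abs by eventually_elim (use m in simp)
  have f_int: "integrable circ_meas (\<lambda>t. f (cis t))"
    by (rule circ.integrable_const_bound[OF f_bd]) measurable
  have L2: "L2T f"
    by (rule L2T_of_bounded[OF _ f_bd]) (simp add: T_measurable_def)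
  have "fourier_coeff f n = 0" if "n < 0" for n
  proof -
    \<comment> \<open>For negative \<open>n\<close> the character is a positive power of
      \<open>cis t\<close>, and \<open>E j z * z ^ N\<close> is entire and vanishes at 0, hence has
      mean 0.\<close>
    define N where "N = nat (- n)"
    have N: "0 < N" "cis (- (of_int n * t)) = cis t ^ N" for t
      using that by (auto simp: N_def Complex.DeMoivre)
    have "(\<lambda>t. cis (- (of_int n * t))) \<in> borel_measurable circ_meas"
      unfolding N by measurable
    from tendsto_integral_mult_bounded[OF E_meas f_meas this E_lim E_bd, where C = 1]
    have "(\<lambda>j. \<integral>t. E j (cis t) * cis t ^ N \<partial>circ_meas) \<longlonglongrightarrow> (\<integral>t. f (cis t) * cis (- (of_int n * t)) \<partial>circ_meas)"
      unfolding N by (simp add: norm_power)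
    moreover have "(\<integral>t. E j (cis t) * cis t ^ N \<partial>circ_meas) = 0" for j
      using circ_mean_value_entire[of "\<lambda>z. E j z * z ^ N"] N(1)
      by (simp add: E_hol holomorphic_intros)
    ultimately have "(\<integral>t. f (cis t) * cis (- (of_int n * t)) \<partial>circ_meas) = 0"
      by (simp add: LIMSEQ_const_iff)
    then show ?thesis by (simp add: fourier_coeff_def)
  qed
  then have H2: "H2_D f" using L2 by (simp add: H2_D_def)
  \<comment> \<open>Inside the disc both sides are Cauchy integrals of their boundary values, so
    bounded convergence on the circle carries over to pointwise convergence in the disc.\<close>
  have ext: "(\<lambda>j. E j z) \<longlonglongrightarrow> H2_ext f z" if z: "cmod z < 1" for z
  proof -
    have [measurable]: "(\<lambda>t. 1 / (1 - z * cis (-t))) \<in> borel_measurable circ_meas"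
      unfolding circ_meas_def
      by (intro continuous_imp_measurable_on_sets_lebesgue continuous_intros)
         (use one_minus_mult_cis_nonzero[OF z] in auto)
    have "cmod (1 / (1 - z * cis (-t))) \<le> 1 / (1 - cmod z)" for t
      using norm_one_minus_mult_cis_ge[of z "-t"] z by (simp add: norm_divide frac_le)
    from tendsto_integral_mult_bounded[OF E_meas f_meas _ E_lim E_bd this]
    have "(\<lambda>j. (\<integral>t. E j (cis t) / (1 - z * cis (-t)) \<partial>circ_meas) / complex_of_real (2*pi))
       \<longlonglongrightarrow> (\<integral>t. f (cis t) / (1 - z * cis (-t)) \<partial>circ_meas) / complex_of_real (2*pi)"
      by (intro tendsto_divide) auto
    moreover have "(\<integral>t. E j (cis t) / (1 - z * cis (-t)) \<partial>circ_meas) / complex_of_real (2*pi) = E j z" for j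
      using z by (subst circ_Cauchy_integral)
        (auto intro: E_hol holomorphic_on_imp_continuous_on)
    ultimately show ?thesis by (simp add: H2_ext_eq[OF f_int z])
  qed
  \<comment> \<open>The maximum principle for \<open>- h\<close> carries the lower bound on
    \<open>Re h\<close> into the disc; its error \<open>1 / Suc (\<sigma> j)\<close> vanishes in the
    limit.\<close>
  have lower: "exp m \<le> cmod (H2_ext f z)" if z: "cmod z < 1" for z
  proof (rule LIMSEQ_le)
    show "(\<lambda>j. cmod (E j z)) \<longlonglongrightarrow> cmod (H2_ext f z)" by (intro tendsto_norm ext z)
    have "(\<lambda>j. m - 1 / real (Suc j)) \<longlonglongrightarrow> m - 0"
      by (intro tendsto_intros LIMSEQ_Suc lim_1_over_n)
    from LIMSEQ_subseq_LIMSEQ[OF tendsto_exp[OF this] \<sigma>(1)]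
    show "(\<lambda>j. exp (m - 1 / real (Suc (\<sigma> j)))) \<longlonglongrightarrow> exp m" by (simp add: o_def)
    show "\<exists>N. \<forall>j\<ge>N. exp (m - 1 / real (Suc (\<sigma> j))) \<le> cmod (E j z)"
      unfolding E_def norm_exp_eq_Re
      by (intro exI[of _ 0] allI impI, subst exp_le_cancel_iff)
         (rule Re_poly_ge_on_disc[OF h(2) z])
  qed
  \<comment> \<open>As \<open>h\<close> is real at 0, \<open>E j 0\<close> is a positive real and
    equals its own modulus. The limit is then real and equal to its modulus, which
    \<open>lower\<close> keeps away from 0.\<close>
  have E0: "Im (E j 0) = 0" "Re (E j 0) = cmod (E j 0)" for j
    unfolding E_def using h(1)[of "\<sigma> j"] by (simp_all add: Im_exp Re_exp)
  have lim0: "(\<lambda>j. E j 0) \<longlonglongrightarrow> H2_ext f 0" by (rule ext) simp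
  have "Im (H2_ext f 0) = 0"
    using tendsto_Im[OF lim0] by (simp add: E0 LIMSEQ_const_iff)
  moreover have re: "Re (H2_ext f 0) = cmod (H2_ext f 0)"
    using tendsto_Re[OF lim0] tendsto_norm[OF lim0] LIMSEQ_unique unfolding E0 by blast
  moreover have "0 < Re (H2_ext f 0)"
    unfolding re using order_less_le_trans[OF exp_gt_zero lower[of 0]] by simp
  ultimately show ?thesis using that[OF H2 f_abs lower] by blast
qed

lemma cstar_cis: "cstar a (cis t) = cnj (a (cis t))"
  by (simp add: cstar_def cis_cnj flip: cis_inverse inverse_eq_divide)

text \<open>The outer function with modulus \<open>sqrt (1 - \<bar>b\<bar>\<^sup>2)\<close> on the
  circle is bounded below in the disc by \<open>sqrt (1 - c)\<close>, and \<open>1 - c > 1/2\<close>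
  gives the strict inequality for the infimum.\<close>

lemma B_pairs_exists:
  fixes b :: "complex \<Rightarrow> complex"
  assumes b: "T_measurable b" and c: "0 < c" "c < 1/2"
    and bc: "AE t in circ_meas. (cmod (b (cis t)))\<^sup>2 \<le> c"
  shows "\<exists>a. T_measurable a \<and> (a, b) \<in> B_pairs"
proof -
  have b_meas [measurable]: "(\<lambda>t. b (cis t)) \<in> borel_measurable circ_meas" using b by (simp add: T_measurable_def)
  define m where "m = ln (1 - c) / 2"
  \<comment> \<open>The truncation makes the bounds hold for every \<open>t\<close>, including those
    where the logarithm has an argument outside \<open>[1 - c, 1]\<close>; almost everywhere it
    changes nothing.\<close>
  define u where "u = (\<lambda>t. max m (min 0 (ln (1 - (cmod (b (cis t)))\<^sup>2) / 2)))"
  have m0: "m \<le> 0" using c by (simp add: m_def)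
  have u_meas: "u \<in> borel_measurable circ_meas" unfolding u_def by measurable
  have "m \<le> u t" "u t \<le> 0" for t using m0 by (auto simp: u_def)
  from outer_function_exists[OF u_meas this]
  obtain f where f: "H2_D f" "AE t in circ_meas. cmod (f (cis t)) = exp (u t)"
    "\<And>z. cmod z < 1 \<Longrightarrow> exp m \<le> cmod (H2_ext f z)"
    "Im (H2_ext f 0) = 0" "0 < Re (H2_ext f 0)" by blast
  have exp_m: "(exp m)\<^sup>2 = 1 - c"
    using c by (simp add: m_def flip: exp_double)
  have f_abs: "AE t in circ_meas. (cmod (f (cis t)))\<^sup>2 = 1 - (cmod (b (cis t)))\<^sup>2"
    using f(2) bc
  proof eventually_elim
    case (elim t)
    define w where "w = 1 - (cmod (b (cis t)))\<^sup>2"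
    have w: "1 - c \<le> w" "w \<le> 1" using elim by (auto simp: w_def)
    then have "ln (1 - c) \<le> ln w" "ln w \<le> 0" using c by auto
    then have "u t = ln w / 2" by (auto simp: u_def m_def w_def)
    then have "(exp (u t))\<^sup>2 = exp (ln w)" by (simp flip: exp_double)
    then have "(exp (u t))\<^sup>2 = w" using w c by simp
    then show ?case using elim(1) w_def by simp
  qed
  \<comment> \<open>Reflection in the circle is an involution, also at 0 because
    \<open>1 / 0 = 0\<close>; so \<open>cstar a\<close> equals \<open>f\<close> everywhere and not
    just on the circle.\<close>
  define a where "a = (\<lambda>z. cnj (f (1 / cnj z)))"
  have star: "cstar a = f" by (simp add: cstar_def a_def fun_eq_iff)
  have a_cis: "a (cis t) = cnj (f (cis t))" for t
    by (simp add: a_def cis_cnj flip: cis_inverse inverse_eq_divide)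
  have f_meas [measurable]: "(\<lambda>t. f (cis t)) \<in> borel_measurable circ_meas"
    using f(1) by (simp add: H2_D_def L2T_def T_measurable_def)
  have a_meas: "T_measurable a"
    unfolding T_measurable_def a_cis
    by (rule measurable_compose[OF f_meas borel_measurable_continuous_onI]) (intro continuous_intros)
  have "AE t in circ_meas. a (cis t) * cstar a (cis t) + b (cis t) * cstar b (cis t) = 1"
    using f_abs
  proof eventually_elim
    case (elim t)
    have "a (cis t) * cstar a (cis t) + b (cis t) * cstar b (cis t)
      = complex_of_real ((cmod (f (cis t)))\<^sup>2 + (cmod (b (cis t)))\<^sup>2)"
      by (simp only: a_cis cstar_cis complex_cnj_cnj of_real_add complex_norm_square mult.commute)
    then show ?case using elim by simp
  qed
  then have L: "(a, b) \<in> L_pairs"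
    using a_meas b f(1,4,5) by (simp add: L_pairs_def H2_Dstar_def at_infty_def star)
  have sq: "1 - c \<le> (cmod (H2_ext f z))\<^sup>2" if "cmod z < 1" for z
    unfolding exp_m[symmetric] using f(3)[OF that] by (intro power_mono) auto
  have inv: "1 / cmod w < 1" if "1 < cmod w" for w :: complex
    using that by (subst divide_less_eq_1_pos) auto
  \<comment> \<open>Every point of the exterior disc is the reflection of a point of the disc, with
    infinity corresponding to 0.\<close>
  have "1 - c \<le> Inf ((\<lambda>w. (cmod (Dstar_ext a w))\<^sup>2) ` {w. 1 < cmod w} \<union> {(cmod (at_infty a))\<^sup>2})"
    by (rule cInf_greatest)
      (auto simp: Dstar_ext_def at_infty_def star norm_divide inv intro!: sq)
  then have "(a, b) \<in> B_pairs" using L c by (simp add: B_pairs_def)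
  then show ?thesis using a_meas by blast
qed

section \<open>Radial limits in \<open>L\<^sup>2\<close>\<close>

lemma L2T_measurable: "L2T f \<Longrightarrow> (\<lambda>t. f (cis t)) \<in> borel_measurable circ_meas"
  by (simp add: L2T_def T_measurable_def)

lemma L2T_integrable_sq: "L2T f \<Longrightarrow> integrable circ_meas (\<lambda>t. (cmod (f (cis t)))\<^sup>2)"
  by (simp add: L2T_def)

lemma L2T_integrable_mult:
  assumes "L2T f" "L2T g"
  shows "integrable circ_meas (\<lambda>t. f (cis t) * g (cis t))"
proof (rule Bochner_Integration.integrable_bound)
  show "integrable circ_meas (\<lambda>t. (cmod (f (cis t)))\<^sup>2 + (cmod (g (cis t)))\<^sup>2)"
    using assms by (intro Bochner_Integration.integrable_add L2T_integrable_sq)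
  show "(\<lambda>t. f (cis t) * g (cis t)) \<in> borel_measurable circ_meas"
    using assms[THEN L2T_measurable] by measurable
  have "x * y \<le> x\<^sup>2 + y\<^sup>2" if "0 \<le> x" "0 \<le> y" for x y :: real
  proof -
    have "2 * (x * y) \<le> x\<^sup>2 + y\<^sup>2" using sum_squares_bound[of x y] by (simp add: mult.assoc)
    moreover have "0 \<le> x * y" using that by simp
    ultimately show ?thesis by linarith
  qed
  then show "AE t in circ_meas. norm (f (cis t) * g (cis t)) \<le> norm ((cmod (f (cis t)))\<^sup>2 + (cmod (g (cis t)))\<^sup>2)"
    by (simp add: norm_mult)
qed

lemma L2T_const: "L2T (\<lambda>z. c)"
  by (rule L2T_of_bounded[where B = "cmod c"]) (auto simp: T_measurable_def)

lemma L2T_integrable: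
  assumes "L2T f" shows "integrable circ_meas (\<lambda>t. f (cis t))"
  using L2T_integrable_mult[OF assms L2T_const[of 1]] by simp

lemma L2T_diff:
  assumes "L2T f" "L2T g" shows "L2T (\<lambda>z. f z - g z)"
proof -
  note [measurable] = assms[THEN L2T_measurable]
  have "integrable circ_meas (\<lambda>t. (cmod (f (cis t) - g (cis t)))\<^sup>2)"
  proof (rule Bochner_Integration.integrable_bound)
    show "integrable circ_meas (\<lambda>t. 2 * (cmod (f (cis t)))\<^sup>2 + 2 * (cmod (g (cis t)))\<^sup>2)"
      using assms by (intro Bochner_Integration.integrable_add integrable_mult_right L2T_integrable_sq)
    have "(cmod (x - y))\<^sup>2 \<le> 2 * (cmod x)\<^sup>2 + 2 * (cmod y)\<^sup>2" for x y :: complex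
    proof -
      have "(cmod (x - y))\<^sup>2 \<le> (cmod x + cmod y)\<^sup>2" by (intro power_mono norm_triangle_ineq4) auto
      also have "\<dots> \<le> 2 * (cmod x)\<^sup>2 + 2 * (cmod y)\<^sup>2"
        using sum_squares_bound[of "cmod x" "cmod y"] by (simp add: power2_sum)
      finally show ?thesis .
    qed
    then show "AE t in circ_meas. norm ((cmod (f (cis t) - g (cis t)))\<^sup>2)
        \<le> norm (2 * (cmod (f (cis t)))\<^sup>2 + 2 * (cmod (g (cis t)))\<^sup>2)" by simp
  qed measurable
  then show ?thesis by (simp add: L2T_def T_measurable_def)
qed

lemma L2T_continuous:
  assumes "continuous_on (sphere 0 1) f" shows "L2T f"
  unfolding L2T_def T_measurable_def
  using assms by (auto intro!: measurable_cis_comp_continuous integrable_cis_comp_continuous continuous_intros)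

lemma L2T_cnj: "L2T f \<Longrightarrow> L2T (\<lambda>z. cnj (f z))"
  unfolding L2T_def T_measurable_def
  using measurable_compose[OF _ borel_measurable_continuous_onI[of cnj]] continuous_on_cnj[OF continuous_on_id]
  by auto

lemma cmod_diff_sq: "(cmod (x - y))\<^sup>2 = (cmod x)\<^sup>2 + (cmod y)\<^sup>2 - 2 * Re (x * cnj y)"
  by (simp add: cmod_power2) (simp add: power2_eq_square algebra_simps)

lemma integral_cmod_diff_sq:
  assumes "L2T f" "L2T g"
  shows "(\<integral>t. (cmod (f (cis t) - g (cis t)))\<^sup>2 \<partial>circ_meas) =
    (\<integral>t. (cmod (f (cis t)))\<^sup>2 \<partial>circ_meas) + (\<integral>t. (cmod (g (cis t)))\<^sup>2 \<partial>circ_meas)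
     - 2 * Re (\<integral>t. f (cis t) * cnj (g (cis t)) \<partial>circ_meas)"
proof -
  define h where "h = (\<lambda>t. f (cis t) * cnj (g (cis t)))"
  have h: "integrable circ_meas h"
    unfolding h_def by (rule L2T_integrable_mult[OF assms(1) L2T_cnj[OF assms(2)]])
  have "(cmod (f (cis t) - g (cis t)))\<^sup>2 = (cmod (f (cis t)))\<^sup>2 + (cmod (g (cis t)))\<^sup>2 - 2 * Re (h t)" for t
    unfolding h_def by (rule cmod_diff_sq)
  then show ?thesis
    unfolding h_def[symmetric] using h assms[THEN L2T_integrable_sq] by simp
qed

section \<open>Orthogonality of powers and Bessel's inequality\<close>

lemma integral_cis_power_mult_cnj:
  "(\<integral>t. cis t ^ j * cnj (cis t ^ k) \<partial>circ_meas) = (if j = k then 2 * pi else 0)"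
proof -
  have 1: "(\<integral>t. cis t ^ (k + i) * cnj (cis t ^ k) \<partial>circ_meas) = (if i = 0 then 2 * pi else 0)" for i k
  proof -
    have "cis t ^ k * cnj (cis t ^ k) = 1" for t
      using complex_norm_square[of "cis t ^ k"] by (simp add: norm_power)
    then have "cis t ^ (k + i) * cnj (cis t ^ k) = cis t ^ i" for t
      by (simp add: power_add mult.assoc mult.commute mult.left_commute)
    then show ?thesis using circ_mean_value_entire[of "\<lambda>z. z ^ i"] by (simp add: holomorphic_intros)
  qed
  show ?thesis
  proof (cases "k \<le> j")
    case True
    then show ?thesis using 1[of k "j - k"] by auto
  next
    case False
    have "(\<integral>t. cis t ^ j * cnj (cis t ^ k) \<partial>circ_meas) = (\<integral>t. cnj (cis t ^ k * cnj (cis t ^ j)) \<partial>circ_meas)"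
      by (simp add: mult.commute)
    also have "\<dots> = cnj (\<integral>t. cis t ^ k * cnj (cis t ^ j) \<partial>circ_meas)"
      by (rule Bochner_Integration.integral_cnj)
    finally show ?thesis using 1[of j "k - j"] False by auto
  qed
qed

lemma L2T_trig_sum: "L2T (\<lambda>z. \<Sum>n<N. a n * z ^ n)"
  by (intro L2T_continuous continuous_intros)

lemma integral_mult_cnj_trig_sum:
  assumes "L2T f"
  shows "(\<integral>t. f (cis t) * cnj (\<Sum>n<N. a n * cis t ^ n) \<partial>circ_meas)
     = 2 * pi * (\<Sum>n<N. cnj (a n) * fourier_coeff f (int n))"
proof -
  have i: "integrable circ_meas (\<lambda>t. f (cis t) * cnj (cis t ^ n))" for n
    by (intro L2T_integrable_mult[OF assms, of "\<lambda>z. cnj (z ^ n)"] L2T_continuous continuous_intros)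
  have c: "(\<integral>t. f (cis t) * cnj (cis t ^ n) \<partial>circ_meas) = 2 * pi * fourier_coeff f (int n)" for n
  proof -
    have "cnj (cis t ^ n) = cis (- (of_int (int n) * t))" for t
      by (simp add: cis_cnj Complex.DeMoivre)
    then show ?thesis by (simp add: fourier_coeff_def)
  qed
  have "(\<integral>t. f (cis t) * cnj (\<Sum>n<N. a n * cis t ^ n) \<partial>circ_meas)
    = (\<integral>t. (\<Sum>n<N. cnj (a n) * (f (cis t) * cnj (cis t ^ n))) \<partial>circ_meas)"
    by (simp add: sum_distrib_left mult.left_commute)
  also have "\<dots> = (\<Sum>n<N. cnj (a n) * (2 * pi * fourier_coeff f (int n)))"
    using i unfolding c[symmetric] by (subst Bochner_Integration.integral_sum) (auto intro!: integrable_mult_right)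
  finally show ?thesis by (simp add: sum_distrib_left mult.left_commute)
qed

lemma fourier_coeff_trig_sum:
  "fourier_coeff (\<lambda>z. \<Sum>n<N. a n * z ^ n) (int m) = (if m < N then a m else 0)"
proof -
  have i: "integrable circ_meas (\<lambda>t. cis t ^ n * cnj (cis t ^ m))" for n
    by (rule integrable_cis_comp_continuous) (intro continuous_intros)
  have "(\<integral>t. (\<Sum>n<N. a n * cis t ^ n) * cis (- (of_int (int m) * t)) \<partial>circ_meas)
    = (\<integral>t. (\<Sum>n<N. a n * (cis t ^ n * cnj (cis t ^ m))) \<partial>circ_meas)"
    by (simp add: cis_cnj Complex.DeMoivre sum_distrib_right mult.assoc)
  also have "\<dots> = (\<Sum>n<N. a n * (if n = m then 2 * pi else 0))"
    unfolding integral_cis_power_mult_cnj[symmetric]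
    by (subst Bochner_Integration.integral_sum[OF integrable_mult_right[OF i]]) (simp only: Bochner_Integration.integral_mult_right[OF i])
  also have "\<dots> = (if m < N then a m * (2 * pi) else 0)"
    by (simp add: if_distrib sum.delta cong: if_cong)
  finally show ?thesis by (simp add: fourier_coeff_def)
qed

lemma integral_cmod_trig_sum_sq:
  "(\<integral>t. (cmod (\<Sum>n<N. a n * cis t ^ n))\<^sup>2 \<partial>circ_meas) = 2 * pi * (\<Sum>n<N. (cmod (a n))\<^sup>2)"
proof -
  have "complex_of_real (\<integral>t. (cmod (\<Sum>n<N. a n * cis t ^ n))\<^sup>2 \<partial>circ_meas)
    = (\<integral>t. (\<Sum>n<N. a n * cis t ^ n) * cnj (\<Sum>n<N. a n * cis t ^ n) \<partial>circ_meas)"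
    unfolding complex_norm_square[symmetric] by (rule integral_complex_of_real[symmetric])
  also have "\<dots> = 2 * pi * (\<Sum>n<N. cnj (a n) * a n)"
    by (subst integral_mult_cnj_trig_sum[OF L2T_trig_sum]) (simp add: fourier_coeff_trig_sum)
  also have "(\<Sum>n<N. cnj (a n) * a n) = complex_of_real (\<Sum>n<N. (cmod (a n))\<^sup>2)"
    by (simp only: of_real_sum complex_norm_square mult.commute)
  finally have "complex_of_real (\<integral>t. (cmod (\<Sum>n<N. a n * cis t ^ n))\<^sup>2 \<partial>circ_meas)
    = complex_of_real (2 * pi * (\<Sum>n<N. (cmod (a n))\<^sup>2))"
    by (simp only: of_real_mult)
  then show ?thesis by (simp only: of_real_eq_iff)
qed

lemma Bessel_inequality:
  assumes "L2T f"
  shows "2 * pi * (\<Sum>n<N. (cmod (fourier_coeff f (int n)))\<^sup>2) \<le> (\<integral>t. (cmod (f (cis t)))\<^sup>2 \<partial>circ_meas)"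
proof -
  let ?c = "\<lambda>n. fourier_coeff f (int n)" and ?S = "\<lambda>z. \<Sum>n<N. fourier_coeff f (int n) * z ^ n"
  have *: "(\<Sum>n<N. cnj (?c n) * ?c n) = complex_of_real (\<Sum>n<N. (cmod (?c n))\<^sup>2)"
    by (simp only: of_real_sum complex_norm_square mult.commute)
  have "0 \<le> (\<integral>t. (cmod (f (cis t) - ?S (cis t)))\<^sup>2 \<partial>circ_meas)" by simp
  also have "\<dots> = (\<integral>t. (cmod (f (cis t)))\<^sup>2 \<partial>circ_meas) - 2 * pi * (\<Sum>n<N. (cmod (?c n))\<^sup>2)"
    unfolding integral_cmod_diff_sq[OF assms L2T_trig_sum] integral_cmod_trig_sum_sq
      integral_mult_cnj_trig_sum[OF assms] * by simp
  finally show ?thesis by simp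
qed

text \<open>Dilating by \<open>r\<close> multiplies the n-th coefficient by
  \<open>r ^ n \<le> 1\<close>, so Bessel's inequality bounds all partial sums by the norm of
  \<open>f\<close>. The bound is uniform in \<open>r\<close>, which later lets an approximation of
  \<open>f\<close> be transported to its dilates.\<close>

lemma integral_cmod_H2_ext_sq_le:
  assumes f: "L2T f" and r: "0 \<le> r" "r < 1"
  shows "(\<integral>t. (cmod (H2_ext f (of_real r * cis t)))\<^sup>2 \<partial>circ_meas) \<le> (\<integral>t. (cmod (f (cis t)))\<^sup>2 \<partial>circ_meas)"
proof (rule LIMSEQ_le_const2)
  define c where "c = (\<lambda>n. fourier_coeff f (int n))"
  define T where "T = (\<lambda>N t. \<Sum>n<N. (c n * of_real r ^ n) * cis t ^ n)"
  have T_lim: "(\<lambda>N. T N t) \<longlonglongrightarrow> H2_ext f (of_real r * cis t)" for t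
  proof -
    have "cmod (of_real r * cis t) < 1" using r by (simp add: norm_mult)
    from H2_ext_Cauchy_integral[OF L2T_integrable[OF f] this]
    have "(\<lambda>n. c n * (of_real r * cis t) ^ n) sums H2_ext f (of_real r * cis t)"
      by (simp add: H2_ext_def c_def sums_iff)
    then show ?thesis by (simp add: sums_def T_def power_mult_distrib mult.assoc)
  qed
  have c_bd: "(cmod (c n))\<^sup>2 \<le> (\<integral>t. (cmod (f (cis t)))\<^sup>2 \<partial>circ_meas) / (2 * pi)" for n
  proof -
    have "(cmod (c n))\<^sup>2 \<le> (\<Sum>i<Suc n. (cmod (c i))\<^sup>2)" by (rule member_le_sum) auto
    then have "2 * pi * (cmod (c n))\<^sup>2 \<le> 2 * pi * (\<Sum>i<Suc n. (cmod (c i))\<^sup>2)"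
      by (rule mult_left_mono) simp
    also have "\<dots> \<le> (\<integral>t. (cmod (f (cis t)))\<^sup>2 \<partial>circ_meas)"
      unfolding c_def by (rule Bessel_inequality[OF f])
    finally show ?thesis by (simp add: pos_le_divide_eq mult.commute)
  qed
  \<comment> \<open>By Bessel's inequality this bounds every coefficient; the geometric series then
    gives the constant majorant \<open>C / (1 - r)\<close> for dominated convergence at fixed
    \<open>r\<close>.\<close>
  define C where "C = sqrt ((\<integral>t. (cmod (f (cis t)))\<^sup>2 \<partial>circ_meas) / (2 * pi))"
  have C: "cmod (c n) \<le> C" for n unfolding C_def by (rule real_le_rsqrt) (rule c_bd)
  have T_bd: "cmod (T N t) \<le> C / (1 - r)" for N t
  proof -
    have "0 \<le> C" using C[of 0] norm_ge_zero order_trans by blast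
    have "cmod (T N t) \<le> (\<Sum>n<N. C * r ^ n)"
      unfolding T_def using r C by (intro sum_norm_le) (auto simp: norm_mult norm_power intro: mult_right_mono)
    also have "\<dots> \<le> (\<Sum>n. C * r ^ n)"
      using r \<open>0 \<le> C\<close> by (intro sum_le_suminf summable_mult summable_geometric) auto
    also have "\<dots> = C / (1 - r)"
      using r by (simp add: suminf_mult summable_geometric suminf_geometric)
    finally show ?thesis .
  qed
  have [measurable]: "(\<lambda>t. T N t) \<in> borel_measurable circ_meas" for N
    unfolding T_def by measurable
  have [measurable]: "(\<lambda>t. H2_ext f (of_real r * cis t)) \<in> borel_measurable circ_meas"
    by (rule borel_measurable_LIMSEQ_metric[OF _ T_lim]) measurable
  show "(\<lambda>N. \<integral>t. (cmod (T N t))\<^sup>2 \<partial>circ_meas) \<longlonglongrightarrow>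
      (\<integral>t. (cmod (H2_ext f (of_real r * cis t)))\<^sup>2 \<partial>circ_meas)"
  proof (rule integral_dominated_convergence[where w = "\<lambda>_. (C / (1 - r))\<^sup>2"])
    show "AE t in circ_meas. (\<lambda>N. (cmod (T N t))\<^sup>2) \<longlonglongrightarrow> (cmod (H2_ext f (of_real r * cis t)))\<^sup>2"
      using T_lim by (intro AE_I2 tendsto_intros)
    show "AE t in circ_meas. norm ((cmod (T N t))\<^sup>2) \<le> (C / (1 - r))\<^sup>2" for N
      using T_bd by (simp add: power_mono)
  qed auto
  have "(\<integral>t. (cmod (T N t))\<^sup>2 \<partial>circ_meas) \<le> (\<integral>t. (cmod (f (cis t)))\<^sup>2 \<partial>circ_meas)" for N
  proof -
    have "(\<integral>t. (cmod (T N t))\<^sup>2 \<partial>circ_meas) = 2 * pi * (\<Sum>n<N. (cmod (c n * of_real r ^ n))\<^sup>2)"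
      unfolding T_def by (rule integral_cmod_trig_sum_sq)
    also have "\<dots> \<le> 2 * pi * (\<Sum>n<N. (cmod (c n))\<^sup>2)"
      using r by (intro mult_left_mono sum_mono power_mono)
        (auto simp: norm_mult norm_power intro!: mult_left_le power_le_one)
    also have "\<dots> \<le> (\<integral>t. (cmod (f (cis t)))\<^sup>2 \<partial>circ_meas)"
      unfolding c_def by (rule Bessel_inequality[OF f])
    finally show ?thesis .
  qed
  then show "\<exists>N0. \<forall>N\<ge>N0. (\<integral>t. (cmod (T N t))\<^sup>2 \<partial>circ_meas) \<le> (\<integral>t. (cmod (f (cis t)))\<^sup>2 \<partial>circ_meas)"
    by blast
qed

text \<open>Vanishing of the negative coefficients means orthogonality to conjugates of polynomials
  without constant term.\<close>

lemma H2_D_integral_mult_poly: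
  assumes f: "H2_D f" and s: "poly s 0 = 0"
  shows "(\<integral>t. f (cis t) * poly s (cis t) \<partial>circ_meas) = 0"
proof -
  have L2: "L2T f" using f by (simp add: H2_D_def)
  have i: "integrable circ_meas (\<lambda>t. f (cis t) * cis t ^ n)" for n
    by (intro L2T_integrable_mult[OF L2, of "\<lambda>z. z ^ n"] L2T_continuous continuous_intros)
  have z: "coeff s n * (\<integral>t. f (cis t) * cis t ^ n \<partial>circ_meas) = 0" for n
  proof (cases "n = 0")
    case True
    then show ?thesis using s by (simp add: poly_0_coeff_0)
  next
    case False
    then have "fourier_coeff f (- int n) = 0" using f by (simp add: H2_D_def)
    then show ?thesis by (simp add: fourier_coeff_def Complex.DeMoivre)
  qed
  have "(\<integral>t. f (cis t) * poly s (cis t) \<partial>circ_meas)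
    = (\<integral>t. (\<Sum>n\<le>degree s. coeff s n * (f (cis t) * cis t ^ n)) \<partial>circ_meas)"
    by (simp add: poly_altdef sum_distrib_left mult.left_commute)
  also have "\<dots> = (\<Sum>n\<le>degree s. coeff s n * (\<integral>t. f (cis t) * cis t ^ n \<partial>circ_meas))"
    using i by (subst Bochner_Integration.integral_sum) (auto intro!: integrable_mult_right)
  finally show ?thesis using z by simp
qed

text \<open>Approximating real and imaginary parts separately gives \<open>P = q + cnj s\<close>
  with \<open>s\<close> vanishing at 0. Both \<open>f\<close> and \<open>q\<close> are orthogonal to
  \<open>cnj s\<close>, so by Pythagoras dropping \<open>cnj s\<close> does not increase the
  distance to \<open>f\<close>.\<close>

lemma H2_D_poly_dense:
  assumes f: "H2_D f" and bd: "AE t in circ_meas. cmod (f (cis t)) \<le> 1"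
  obtains q :: "nat \<Rightarrow> complex poly"
  where "(\<lambda>k. \<integral>t. (cmod (f (cis t) - poly (q k) (cis t)))\<^sup>2 \<partial>circ_meas) \<longlonglongrightarrow> 0"
proof -
  have L2: "L2T f" using f by (simp add: H2_D_def)
  note [measurable] = L2T_measurable[OF L2]
  \<comment> \<open>The approximation requires bounds for every \<open>t\<close>, whereas
    \<open>f\<close> is bounded only almost everywhere.\<close>
  define clip where "clip = (\<lambda>x::real. max (- 1) (min 1 x))"
  have clip: "- 1 \<le> clip x" "clip x \<le> 1" for x by (auto simp: clip_def)
  define u where "u = (\<lambda>t. clip (Re (f (cis t))))"
  define v where "v = (\<lambda>t. clip (Im (f (cis t))))"
  have u_meas: "u \<in> borel_measurable circ_meas" and v_meas: "v \<in> borel_measurable circ_meas"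
    unfolding u_def v_def clip_def by measurable
  have u_bd: "- 1 \<le> u t" "u t \<le> 1" and v_bd: "- 1 \<le> v t" "v t \<le> 1" for t
    by (simp_all add: u_def v_def clip)
  have le_01: "- 1 \<le> (0::real)" "0 \<le> (1::real)" by auto
  obtain h :: "nat \<Rightarrow> complex poly" where h:
    "(\<lambda>k. \<integral>t. (Re (poly (h k) (cis t)) - u t)\<^sup>2 \<partial>circ_meas) \<longlonglongrightarrow> 0"
    "\<And>k. integrable circ_meas (\<lambda>t. (Re (poly (h k) (cis t)) - u t)\<^sup>2)"
    by (rule L2_limit_Re_poly[OF u_meas u_bd le_01]) (rule that)
  obtain p :: "nat \<Rightarrow> complex poly" where p:
    "(\<lambda>k. \<integral>t. (Re (poly (p k) (cis t)) - v t)\<^sup>2 \<partial>circ_meas) \<longlonglongrightarrow> 0"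
    "\<And>k. integrable circ_meas (\<lambda>t. (Re (poly (p k) (cis t)) - v t)\<^sup>2)"
    by (rule L2_limit_Re_poly[OF v_meas v_bd le_01]) (rule that)
  define P where "P = (\<lambda>k z. Complex (Re (poly (h k) z)) (Re (poly (p k) z)))"
  \<comment> \<open>Write each real part as half the sum of the polynomial and its conjugate. The
    conjugated constant terms go into \<open>q\<close>, which leaves \<open>s\<close> with value 0
    at 0.\<close>
  define q where "q = (\<lambda>k. smult (1/2) (h k + [:cnj (poly (h k) 0):]) + smult (\<i>/2) (p k + [:cnj (poly (p k) 0):]))"
  define s where "s = (\<lambda>k. smult (1/2) (h k - [:poly (h k) 0:]) - smult (\<i>/2) (p k - [:poly (p k) 0:]))"
  have P: "P k z = poly (q k) z + cnj (poly (s k) z)" for k z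
    by (simp add: P_def q_def s_def complex_eq_iff field_simps)
  have le: "(\<integral>t. (cmod (f (cis t) - poly (q k) (cis t)))\<^sup>2 \<partial>circ_meas)
    \<le> (\<integral>t. (cmod (f (cis t) - P k (cis t)))\<^sup>2 \<partial>circ_meas)" for k
  proof -
    have q2: "L2T (poly (q k))" and s2: "L2T (\<lambda>z. poly (s k) z)"
      by (intro L2T_continuous continuous_intros)+
    have s0: "poly (s k) 0 = 0" by (simp add: s_def)
    have "(\<integral>t. (f (cis t) - poly (q k) (cis t)) * cnj (cnj (poly (s k) (cis t))) \<partial>circ_meas)
      = (\<integral>t. f (cis t) * poly (s k) (cis t) \<partial>circ_meas) - (\<integral>t. poly (q k) (cis t) * poly (s k) (cis t) \<partial>circ_meas)"
      using L2T_integrable_mult[OF L2 s2] L2T_integrable_mult[OF q2 s2] by (simp add: left_diff_distrib)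
    also have "\<dots> = 0"
      using H2_D_integral_mult_poly[OF f s0] circ_mean_value_entire[of "\<lambda>z. poly (q k) z * poly (s k) z"] s0
      by (simp add: holomorphic_intros)
    finally have "(\<integral>t. (cmod (f (cis t) - poly (q k) (cis t) - cnj (poly (s k) (cis t))))\<^sup>2 \<partial>circ_meas)
      = (\<integral>t. (cmod (f (cis t) - poly (q k) (cis t)))\<^sup>2 \<partial>circ_meas) + (\<integral>t. (cmod (cnj (poly (s k) (cis t))))\<^sup>2 \<partial>circ_meas)"
      by (subst integral_cmod_diff_sq[OF L2T_diff[OF L2 q2] L2T_cnj[OF s2]]) simp
    moreover have "0 \<le> (\<integral>t. (cmod (cnj (poly (s k) (cis t))))\<^sup>2 \<partial>circ_meas)" by simp
    ultimately show ?thesis by (simp add: P diff_diff_eq)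
  qed
  have eq: "(\<integral>t. (cmod (f (cis t) - P k (cis t)))\<^sup>2 \<partial>circ_meas)
    = (\<integral>t. (Re (poly (h k) (cis t)) - u t)\<^sup>2 \<partial>circ_meas) + (\<integral>t. (Re (poly (p k) (cis t)) - v t)\<^sup>2 \<partial>circ_meas)" for k
  proof -
    have "(\<integral>t. (cmod (f (cis t) - P k (cis t)))\<^sup>2 \<partial>circ_meas)
      = (\<integral>t. (Re (poly (h k) (cis t)) - u t)\<^sup>2 + (Re (poly (p k) (cis t)) - v t)\<^sup>2 \<partial>circ_meas)"
    proof (rule integral_cong_AE)
      have "continuous_on (sphere 0 1) (P k)"
        unfolding P by (intro continuous_intros)
      then have [measurable]: "(\<lambda>t. P k (cis t)) \<in> borel_measurable circ_meas"
        by (rule measurable_cis_comp_continuous)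
      show "(\<lambda>t. (cmod (f (cis t) - P k (cis t)))\<^sup>2) \<in> borel_measurable circ_meas" by measurable
      show "(\<lambda>t. (Re (poly (h k) (cis t)) - u t)\<^sup>2 + (Re (poly (p k) (cis t)) - v t)\<^sup>2) \<in> borel_measurable circ_meas"
        using h(2) p(2) by (intro borel_measurable_add borel_measurable_integrable)
      show "AE t in circ_meas. (cmod (f (cis t) - P k (cis t)))\<^sup>2
        = (Re (poly (h k) (cis t)) - u t)\<^sup>2 + (Re (poly (p k) (cis t)) - v t)\<^sup>2"
        using bd
      proof eventually_elim
        case (elim t)
        have "\<bar>Re (f (cis t))\<bar> \<le> 1" "\<bar>Im (f (cis t))\<bar> \<le> 1"
          using elim abs_Re_le_cmod abs_Im_le_cmod order_trans by blast+
        then have "u t = Re (f (cis t))" "v t = Im (f (cis t))" by (auto simp: u_def v_def clip_def)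
        then show ?case by (simp add: cmod_power2 P_def power2_commute)
      qed
    qed
    then show ?thesis using h(2) p(2) by simp
  qed
  have "(\<lambda>k. \<integral>t. (cmod (f (cis t) - poly (q k) (cis t)))\<^sup>2 \<partial>circ_meas) \<longlonglongrightarrow> 0"
  proof (rule tendsto_sandwich[OF _ _ tendsto_const])
    show "(\<lambda>k. \<integral>t. (cmod (f (cis t) - P k (cis t)))\<^sup>2 \<partial>circ_meas) \<longlonglongrightarrow> 0"
      unfolding eq using tendsto_add[OF h(1) p(1)] by simp
  qed (use le in auto)
  then show ?thesis by (rule that)
qed

section \<open>Convergence of the dilates to the boundary function\<close>

lemma L2T_H2_ext_radial:
  assumes "integrable circ_meas (\<lambda>t. f (cis t))" "0 \<le> r" "r < 1"
  shows "L2T (\<lambda>z. H2_ext f (of_real r * z))"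
proof (rule L2T_continuous)
  have "continuous_on (ball 0 1) (H2_ext f)"
    by (intro holomorphic_on_imp_continuous_on H2_ext_holomorphic assms)
  then show "continuous_on (sphere 0 1) (\<lambda>z. H2_ext f (of_real r * z))"
    by (rule continuous_on_compose2) (use assms in \<open>auto intro!: continuous_intros simp: norm_mult\<close>)
qed

lemma poly_radial_L2_limit:
  assumes r: "\<And>k. 0 \<le> r k" "\<And>k. r k < 1" "r \<longlonglongrightarrow> 1"
  shows "(\<lambda>k. \<integral>t. (cmod (poly q (of_real (r k) * cis t) - poly q (cis t)))\<^sup>2 \<partial>circ_meas) \<longlonglongrightarrow> 0"
proof -
  have "bounded (poly q ` cball 0 1)"
    by (intro compact_imp_bounded compact_continuous_image continuous_intros) auto
  then obtain K where "\<And>x. x \<in> poly q ` cball 0 1 \<Longrightarrow> cmod x \<le> K"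
    unfolding bounded_iff by blast
  then have K: "cmod (poly q z) \<le> K" if "cmod z \<le> 1" for z using that by simp
  have "(\<lambda>k. \<integral>t. (cmod (poly q (of_real (r k) * cis t) - poly q (cis t)))\<^sup>2 \<partial>circ_meas) \<longlonglongrightarrow> (\<integral>t. 0 \<partial>circ_meas)"
  proof (rule integral_dominated_convergence[where w = "\<lambda>_. (K + K)\<^sup>2"])
    show "(\<lambda>t. (cmod (poly q (of_real (r k) * cis t) - poly q (cis t)))\<^sup>2) \<in> borel_measurable circ_meas" for k
      by (rule measurable_cis_comp_continuous) (intro continuous_intros)
    have "(\<lambda>k. (cmod (poly q (of_real (r k) * cis t) - poly q (cis t)))\<^sup>2)
        \<longlonglongrightarrow> (cmod (poly q (of_real 1 * cis t) - poly q (cis t)))\<^sup>2" for t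
      by (intro tendsto_intros r(3))
    then show "AE t in circ_meas. (\<lambda>k. (cmod (poly q (of_real (r k) * cis t) - poly q (cis t)))\<^sup>2) \<longlonglongrightarrow> 0"
      by simp
    have bd: "cmod (poly q (of_real (r k) * cis t) - poly q (cis t)) \<le> K + K" for k t
    proof -
      have "cmod (poly q (of_real (r k) * cis t)) \<le> K" "cmod (poly q (cis t)) \<le> K"
        using r(1,2)[of k] by (auto intro!: K simp: norm_mult)
      then show ?thesis by (rule order_trans[OF norm_triangle_ineq4 add_mono])
    qed
    have "norm ((cmod (poly q (of_real (r k) * cis t) - poly q (cis t)))\<^sup>2) \<le> (K + K)\<^sup>2" for k t
      using power_mono[OF bd norm_ge_zero, of k t 2] by simp
    then show "AE t in circ_meas. norm ((cmod (poly q (of_real (r k) * cis t) - poly q (cis t)))\<^sup>2) \<le> (K + K)\<^sup>2" for k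
      by (intro AE_I2)
  qed auto
  then show ?thesis by simp
qed

text \<open>Compare \<open>f\<close> with a nearby polynomial \<open>q\<close>. The dilates of
  \<open>f\<close> and \<open>q\<close> are at least as close as \<open>f\<close> and
  \<open>q\<close> by \<open>integral_cmod_H2_ext_sq_le\<close>, and for \<open>q\<close> itself the
  convergence is elementary.\<close>

lemma H2_ext_radial_L2_limit:
  assumes f: "H2_D f" and bd: "AE t in circ_meas. cmod (f (cis t)) \<le> 1"
    and r: "\<And>k. 0 \<le> r k" "\<And>k. r k < 1" "r \<longlonglongrightarrow> 1"
  shows "(\<lambda>k. \<integral>t. (cmod (H2_ext f (of_real (r k) * cis t) - f (cis t)))\<^sup>2 \<partial>circ_meas) \<longlonglongrightarrow> 0"
proof (rule LIMSEQ_I)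
  fix e :: real assume e: "0 < e"
  have L2: "L2T f" using f by (simp add: H2_D_def)
  obtain q0 :: "nat \<Rightarrow> complex poly" where
    "(\<lambda>k. \<integral>t. (cmod (f (cis t) - poly (q0 k) (cis t)))\<^sup>2 \<partial>circ_meas) \<longlonglongrightarrow> 0"
    using H2_D_poly_dense[OF f bd] by blast
  \<comment> \<open>Each of the three terms below enters with factor 3, from \<open>(x + y +
    z)\<^sup>2 \<le> 3 * (x\<^sup>2 + y\<^sup>2 + z\<^sup>2)\<close>, so \<open>e / 9\<close> for
    each suffices.\<close>
  then have "\<forall>\<^sub>F k in sequentially. (\<integral>t. (cmod (f (cis t) - poly (q0 k) (cis t)))\<^sup>2 \<partial>circ_meas) < e / 9"
    using e by (intro order_tendstoD(2)) auto
  then obtain q where q: "(\<integral>t. (cmod (f (cis t) - poly q (cis t)))\<^sup>2 \<partial>circ_meas) < e / 9"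
    by (auto simp: eventually_sequentially)
  have q2: "L2T (poly q)" by (intro L2T_continuous continuous_intros)
  obtain N where N: "\<And>k. N \<le> k \<Longrightarrow> (\<integral>t. (cmod (poly q (of_real (r k) * cis t) - poly q (cis t)))\<^sup>2 \<partial>circ_meas) < e / 9"
    using order_tendstoD(2)[OF poly_radial_L2_limit[OF r], of "e/9" q] e by (auto simp: eventually_sequentially)
  have "(\<integral>t. (cmod (H2_ext f (of_real (r k) * cis t) - f (cis t)))\<^sup>2 \<partial>circ_meas) < e" if k: "N \<le> k" for k
  proof -
    let ?F = "\<lambda>z. H2_ext f (of_real (r k) * z)" and ?q = "\<lambda>z. poly q (of_real (r k) * z)"
    have F2: "L2T ?F" by (intro L2T_H2_ext_radial L2T_integrable[OF L2] r)
    have qr2: "L2T ?q" by (intro L2T_continuous continuous_intros)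
    have i1: "integrable circ_meas (\<lambda>t. (cmod (?F (cis t) - ?q (cis t)))\<^sup>2)"
      by (rule L2T_integrable_sq[OF L2T_diff[OF F2 qr2]])
    have i2: "integrable circ_meas (\<lambda>t. (cmod (?q (cis t) - poly q (cis t)))\<^sup>2)"
      by (rule L2T_integrable_sq[OF L2T_diff[OF qr2 q2]])
    have i3: "integrable circ_meas (\<lambda>t. (cmod (f (cis t) - poly q (cis t)))\<^sup>2)"
      by (rule L2T_integrable_sq[OF L2T_diff[OF L2 q2]])
    have i4: "integrable circ_meas (\<lambda>t. (cmod (?F (cis t) - f (cis t)))\<^sup>2)"
      by (rule L2T_integrable_sq[OF L2T_diff[OF F2 L2]])
    have sq: "(x + y + z)\<^sup>2 \<le> 3 * x\<^sup>2 + 3 * y\<^sup>2 + 3 * z\<^sup>2" for x y z :: real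
      using zero_le_power2[of "x - y"] zero_le_power2[of "y - z"] zero_le_power2[of "x - z"]
      by (simp add: power2_eq_square algebra_simps)
    have "(cmod (a - b))\<^sup>2 \<le> 3 * (cmod (a - c))\<^sup>2 + 3 * (cmod (c - d))\<^sup>2 + 3 * (cmod (b - d))\<^sup>2" for a b c d
    proof -
      have "cmod (a - b) \<le> cmod (a - c) + cmod (c - d) + cmod (b - d)"
        using norm_triangle_ineq[of "a - c" "c - d"] norm_triangle_ineq4[of "(a - c) + (c - d)" "b - d"] by simp
      then have "(cmod (a - b))\<^sup>2 \<le> (cmod (a - c) + cmod (c - d) + cmod (b - d))\<^sup>2" by (rule power_mono) simp
      then show ?thesis using sq order_trans by blast
    qed
    then have "(\<integral>t. (cmod (?F (cis t) - f (cis t)))\<^sup>2 \<partial>circ_meas) \<le>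
      (\<integral>t. 3 * (cmod (?F (cis t) - ?q (cis t)))\<^sup>2 + 3 * (cmod (?q (cis t) - poly q (cis t)))\<^sup>2
         + 3 * (cmod (f (cis t) - poly q (cis t)))\<^sup>2 \<partial>circ_meas)"
      by (intro integral_mono i4 Bochner_Integration.integrable_add integrable_mult_right i1 i2 i3)
    also have "\<dots> = 3 * (\<integral>t. (cmod (?F (cis t) - ?q (cis t)))\<^sup>2 \<partial>circ_meas)
       + 3 * (\<integral>t. (cmod (?q (cis t) - poly q (cis t)))\<^sup>2 \<partial>circ_meas)
       + 3 * (\<integral>t. (cmod (f (cis t) - poly q (cis t)))\<^sup>2 \<partial>circ_meas)"
      using i1 i2 i3 by simp
    moreover have "(\<integral>t. (cmod (?F (cis t) - ?q (cis t)))\<^sup>2 \<partial>circ_meas)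
      \<le> (\<integral>t. (cmod (f (cis t) - poly q (cis t)))\<^sup>2 \<partial>circ_meas)"
    proof -
      have "?F (cis t) - ?q (cis t) = H2_ext (\<lambda>z. f z - poly q z) (of_real (r k) * cis t)" for t
      proof -
        have z: "cmod (of_real (r k) * cis t) < 1" using r(1,2)[of k] by (simp add: norm_mult)
        have "H2_ext (poly q) (of_real (r k) * cis t) = poly q (of_real (r k) * cis t)"
          by (rule H2_ext_of_holomorphic[OF _ _ z]) (intro continuous_intros holomorphic_intros)+
        then show ?thesis
          using H2_ext_diff[OF L2T_integrable[OF L2] L2T_integrable[OF q2] z] by simp
      qed
      then show ?thesis
        using integral_cmod_H2_ext_sq_le[OF L2T_diff[OF L2 q2] r(1,2)[of k]] by simp
    qed
    ultimately show ?thesis using q N[OF k] by simp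
  qed
  then show "\<exists>N. \<forall>k\<ge>N. norm ((\<integral>t. (cmod (H2_ext f (of_real (r k) * cis t) - f (cis t)))\<^sup>2 \<partial>circ_meas) - 0) < e"
    by auto
qed

lemma integral_cmod_tendsto_0:
  assumes d: "\<And>k. L2T (d k)"
    and lim: "(\<lambda>k. \<integral>t. (cmod (d k (cis t)))\<^sup>2 \<partial>circ_meas) \<longlonglongrightarrow> 0"
  shows "(\<lambda>k. \<integral>t. cmod (d k (cis t)) \<partial>circ_meas) \<longlonglongrightarrow> 0"
proof (rule LIMSEQ_I)
  fix e :: real assume e: "0 < e"
  \<comment> \<open>The inequality \<open>x \<le> \<epsilon> + x\<^sup>2 / \<epsilon>\<close> takes
    the place of Cauchy-Schwarz. The circle has length \<open>2 * pi\<close>, so the constant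
    contributes \<open>e / 2\<close>, and \<open>N\<close> is chosen to make the other term less
    than \<open>e / 2\<close>.\<close>
  define \<epsilon> where "\<epsilon> = e / (4 * pi)"
  have \<epsilon>: "0 < \<epsilon>" using e by (simp add: \<epsilon>_def)
  obtain N where N: "\<And>k. N \<le> k \<Longrightarrow> (\<integral>t. (cmod (d k (cis t)))\<^sup>2 \<partial>circ_meas) < \<epsilon> * e / 2"
    using order_tendstoD(2)[OF lim, of "\<epsilon> * e / 2"] e \<epsilon> by (auto simp: eventually_sequentially)
  have "(\<integral>t. cmod (d k (cis t)) \<partial>circ_meas) < e" if k: "N \<le> k" for k
  proof -
    have "x \<le> \<epsilon> + x\<^sup>2 / \<epsilon>" if "0 \<le> x" for x :: real
    proof (cases "x \<le> \<epsilon>")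
      case True
      then show ?thesis using \<epsilon> by (simp add: add_increasing2)
    next
      case False
      then have "x * \<epsilon> \<le> x * x" using that by (intro mult_left_mono) auto
      then have "x \<le> x\<^sup>2 / \<epsilon>" using \<epsilon> by (simp add: pos_le_divide_eq power2_eq_square)
      then show ?thesis using \<epsilon> by simp
    qed
    then have "(\<integral>t. cmod (d k (cis t)) \<partial>circ_meas) \<le> (\<integral>t. \<epsilon> + (cmod (d k (cis t)))\<^sup>2 / \<epsilon> \<partial>circ_meas)"
      by (intro integral_mono integrable_norm Bochner_Integration.integrable_add
          integrable_divide L2T_integrable L2T_integrable_sq d) auto
    also have "\<dots> = 2 * pi * \<epsilon> + (\<integral>t. (cmod (d k (cis t)))\<^sup>2 \<partial>circ_meas) / \<epsilon>"
      using L2T_integrable_sq[OF d] by simp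
    also have "\<dots> < 2 * pi * \<epsilon> + (\<epsilon> * e / 2) / \<epsilon>"
      using N[OF k] \<epsilon> by (intro add_strict_left_mono divide_strict_right_mono)
    also have "\<dots> = e" using \<epsilon> by (simp add: \<epsilon>_def)
    finally show ?thesis .
  qed
  then show "\<exists>N. \<forall>k\<ge>N. norm ((\<integral>t. cmod (d k (cis t)) \<partial>circ_meas) - 0) < e"
    by auto
qed

section \<open>Uniqueness\<close>

text \<open>The constant 2 bounds \<open>1 / cmod (B * b)\<close>, since each factor has modulus at
  least \<open>1 / sqrt 2\<close>.\<close>

lemma cmod_quotient_diff_le:
  assumes "1/2 \<le> (cmod B)\<^sup>2" "1/2 \<le> (cmod b)\<^sup>2" "cmod a \<le> 1" "cmod b \<le> 1"
  shows "cmod (A / B - a / b) \<le> 2 * (cmod (A - a) + cmod (B - b))"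
proof -
  have nz: "B \<noteq> 0" "b \<noteq> 0" using assms by auto
  have "1/2 * (1/2) \<le> (cmod B)\<^sup>2 * (cmod b)\<^sup>2" using assms by (intro mult_mono) auto
  then have "(1/2)\<^sup>2 \<le> (cmod (B * b))\<^sup>2" by (simp add: norm_mult power2_eq_square ac_simps)
  then have Bb: "1/2 \<le> cmod (B * b)" by (rule power2_le_imp_le) simp
  have "A / B - a / b = ((A - a) * b - a * (B - b)) / (B * b)"
    using nz by (simp add: field_simps)
  then have "cmod (A / B - a / b) = cmod ((A - a) * b - a * (B - b)) / cmod (B * b)"
    by (simp only: norm_divide)
  also have "\<dots> \<le> cmod ((A - a) * b - a * (B - b)) / (1/2)"
    using Bb by (intro divide_left_mono) auto
  also have "cmod ((A - a) * b - a * (B - b)) \<le> cmod (A - a) * 1 + 1 * cmod (B - b)"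
    by (rule order_trans[OF norm_triangle_ineq4])
      (use assms in \<open>auto simp: norm_mult intro!: add_mono mult_left_mono mult_right_mono mult_left_le mult_left_le_one_le\<close>)
  finally show ?thesis by simp
qed

text \<open>The dilated quotient is holomorphic up to the circle because its denominator stays away
  from 0, so its mean is the value at 0 for every radius. The dilates converge in mean to
  \<open>f\<close> and \<open>g\<close>, and the lower bounds carry this convergence over to the
  quotients.\<close>

lemma integral_H2_quotient:
  assumes f: "H2_D f" "AE t in circ_meas. cmod (f (cis t)) \<le> 1"
    and g: "H2_D g" "AE t in circ_meas. cmod (g (cis t)) \<le> 1"
    and g_ge: "AE t in circ_meas. 1/2 \<le> (cmod (g (cis t)))\<^sup>2"
    and G_ge: "\<And>z. cmod z < 1 \<Longrightarrow> 1/2 \<le> (cmod (H2_ext g z))\<^sup>2"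
  shows "integrable circ_meas (\<lambda>t. f (cis t) / g (cis t))"
    and "(\<integral>t. f (cis t) / g (cis t) \<partial>circ_meas) = 2 * pi * (H2_ext f 0 / H2_ext g 0)"
proof -
  have L2: "L2T f" "L2T g" using f g by (simp_all add: H2_D_def)
  note [measurable] = L2[THEN L2T_measurable]
  have G_nz: "H2_ext g z \<noteq> 0" if "cmod z < 1" for z using G_ge[OF that] by auto
  \<comment> \<open>As \<open>cmod g \<le> 1\<close>, the bound on the square gives
    \<open>cmod g \<ge> (cmod g)\<^sup>2 \<ge> 1/2\<close>.\<close>
  have "AE t in circ_meas. norm (f (cis t) / g (cis t)) \<le> 2"
    using f(2) g(2) g_ge
  proof eventually_elim
    case (elim t)
    have "1/2 * cmod (f (cis t)) \<le> 1/2" using elim by simp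
    also have "\<dots> \<le> cmod (g (cis t)) * cmod (g (cis t))" using elim by (simp add: power2_eq_square)
    also have "\<dots> \<le> cmod (g (cis t)) * 1" using elim by (intro mult_left_mono) auto
    finally show ?case using elim by (simp add: norm_divide divide_le_eq)
  qed
  then show fg: "integrable circ_meas (\<lambda>t. f (cis t) / g (cis t))"
    by (rule circ.integrable_const_bound) measurable
  define r where "r = (\<lambda>k. 1 - 1 / real (Suc k))"
  have r: "0 \<le> r k" "r k < 1" for k by (auto simp: r_def)
  have "r \<longlonglongrightarrow> 1 - 0" unfolding r_def by (intro tendsto_intros LIMSEQ_Suc lim_1_over_n)
  then have r1: "r \<longlonglongrightarrow> 1" by simp
  define F where "F = (\<lambda>k z. H2_ext f (of_real (r k) * z))"
  define G where "G = (\<lambda>k z. H2_ext g (of_real (r k) * z))"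
  have F2: "L2T (F k)" and G2: "L2T (G k)" for k
    unfolding F_def G_def by (intro L2T_H2_ext_radial L2T_integrable L2 r)+
  have quot: "continuous_on (cball 0 1) (\<lambda>z. F k z / G k z)" "(\<lambda>z. F k z / G k z) holomorphic_on ball 0 1" for k
  proof -
    have in_disc: "cmod (of_real (r k) * z) < 1" if "cmod z \<le> 1" for z
    proof -
      have "r k * cmod z \<le> r k * 1" using r(1)[of k] that by (intro mult_left_mono)
      then show ?thesis using r[of k] by (simp add: norm_mult)
    qed
    have hol: "(\<lambda>z. H2_ext f z / H2_ext g z) holomorphic_on ball 0 1"
      using G_nz by (intro holomorphic_on_divide H2_ext_holomorphic L2T_integrable L2) auto
    show "(\<lambda>z. F k z / G k z) holomorphic_on ball 0 1"
      unfolding F_def G_def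
      by (rule holomorphic_on_compose_gen[of "\<lambda>z. of_real (r k) * z" _ _ "ball 0 1", unfolded o_def, OF _ hol])
        (use in_disc in \<open>auto intro!: holomorphic_intros\<close>)
    show "continuous_on (cball 0 1) (\<lambda>z. F k z / G k z)"
      unfolding F_def G_def
      by (rule continuous_on_compose2[OF holomorphic_on_imp_continuous_on[OF hol]])
        (use in_disc in \<open>auto intro!: continuous_intros\<close>)
  qed
  have mean: "(\<integral>t. F k (cis t) / G k (cis t) \<partial>circ_meas) = 2 * pi * (H2_ext f 0 / H2_ext g 0)" for k
    using circ_mean_value[OF quot, of k] by (simp add: F_def G_def)
  have FG: "integrable circ_meas (\<lambda>t. F k (cis t) / G k (cis t))" for k
    by (rule integrable_cis_comp_continuous, rule continuous_on_subset[OF quot(1)]) auto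
  have le: "cmod ((\<integral>t. F k (cis t) / G k (cis t) \<partial>circ_meas) - (\<integral>t. f (cis t) / g (cis t) \<partial>circ_meas))
    \<le> 2 * ((\<integral>t. cmod (F k (cis t) - f (cis t)) \<partial>circ_meas) + (\<integral>t. cmod (G k (cis t) - g (cis t)) \<partial>circ_meas))" for k
  proof -
    have i: "integrable circ_meas (\<lambda>t. cmod (F k (cis t) - f (cis t)))"
      "integrable circ_meas (\<lambda>t. cmod (G k (cis t) - g (cis t)))"
      by (intro integrable_norm Bochner_Integration.integrable_diff L2T_integrable L2 F2 G2)+
    have "cmod ((\<integral>t. F k (cis t) / G k (cis t) \<partial>circ_meas) - (\<integral>t. f (cis t) / g (cis t) \<partial>circ_meas))
      = cmod (\<integral>t. F k (cis t) / G k (cis t) - f (cis t) / g (cis t) \<partial>circ_meas)"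
      using FG fg by simp
    also have "\<dots> \<le> (\<integral>t. cmod (F k (cis t) / G k (cis t) - f (cis t) / g (cis t)) \<partial>circ_meas)"
      by (rule integral_norm_bound)
    also have "\<dots> \<le> (\<integral>t. 2 * (cmod (F k (cis t) - f (cis t)) + cmod (G k (cis t) - g (cis t))) \<partial>circ_meas)"
    proof (rule integral_mono_AE)
      show "AE t in circ_meas. cmod (F k (cis t) / G k (cis t) - f (cis t) / g (cis t))
          \<le> 2 * (cmod (F k (cis t) - f (cis t)) + cmod (G k (cis t) - g (cis t)))"
        using f(2) g(2) g_ge
      proof eventually_elim
        case (elim t)
        have "1/2 \<le> (cmod (G k (cis t)))\<^sup>2"
          unfolding G_def by (rule G_ge) (use r[of k] in \<open>simp add: norm_mult\<close>)
        then show ?case using elim by (intro cmod_quotient_diff_le)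
      qed
    qed (use i FG fg in auto)
    also have "\<dots> = 2 * ((\<integral>t. cmod (F k (cis t) - f (cis t)) \<partial>circ_meas) + (\<integral>t. cmod (G k (cis t) - g (cis t)) \<partial>circ_meas))"
      using i by simp
    finally show ?thesis .
  qed
  have "(\<lambda>k. \<integral>t. cmod (F k (cis t) - f (cis t)) \<partial>circ_meas) \<longlonglongrightarrow> 0"
    using H2_ext_radial_L2_limit[OF f r r1] unfolding F_def[symmetric]
    by (intro integral_cmod_tendsto_0[of "\<lambda>k z. F k z - f z"] L2T_diff F2 L2) (simp add: F_def)
  moreover have "(\<lambda>k. \<integral>t. cmod (G k (cis t) - g (cis t)) \<partial>circ_meas) \<longlonglongrightarrow> 0"
    using H2_ext_radial_L2_limit[OF g r r1] unfolding G_def[symmetric]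
    by (intro integral_cmod_tendsto_0[of "\<lambda>k z. G k z - g z"] L2T_diff G2 L2) (simp add: G_def)
  ultimately have "(\<lambda>k. 2 * ((\<integral>t. cmod (F k (cis t) - f (cis t)) \<partial>circ_meas)
      + (\<integral>t. cmod (G k (cis t) - g (cis t)) \<partial>circ_meas))) \<longlonglongrightarrow> 2 * (0 + 0)"
    by (intro tendsto_intros)
  \<comment> \<open>By \<open>mean\<close> the first integral in \<open>le\<close> is the same
    number for all \<open>k\<close>, so only the right-hand side moves, and it tends to 0.\<close>
  then have "cmod (2 * pi * (H2_ext f 0 / H2_ext g 0) - (\<integral>t. f (cis t) / g (cis t) \<partial>circ_meas)) \<le> 2 * (0 + 0)"
    by (rule LIMSEQ_le_const) (use le in \<open>simp only: mean, blast\<close>)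
  then show "(\<integral>t. f (cis t) / g (cis t) \<partial>circ_meas) = 2 * pi * (H2_ext f 0 / H2_ext g 0)" by simp
qed

lemma H2_D_unique_of_modulus:
  assumes f: "H2_D f" and g: "H2_D g"
    and eq: "AE t in circ_meas. cmod (f (cis t)) = cmod (g (cis t))"
    and le: "AE t in circ_meas. cmod (g (cis t)) \<le> 1"
    and ge: "AE t in circ_meas. 1/2 \<le> (cmod (g (cis t)))\<^sup>2"
    and F_ge: "\<And>z. cmod z < 1 \<Longrightarrow> 1/2 \<le> (cmod (H2_ext f z))\<^sup>2"
    and G_ge: "\<And>z. cmod z < 1 \<Longrightarrow> 1/2 \<le> (cmod (H2_ext g z))\<^sup>2"
    and F0: "Im (H2_ext f 0) = 0" "0 < Re (H2_ext f 0)"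
    and G0: "Im (H2_ext g 0) = 0" "0 < Re (H2_ext g 0)"
  shows "AE t in circ_meas. f (cis t) = g (cis t)"
proof -
  have f_le: "AE t in circ_meas. cmod (f (cis t)) \<le> 1" using eq le by eventually_elim simp
  have f_ge: "AE t in circ_meas. 1/2 \<le> (cmod (f (cis t)))\<^sup>2" using eq ge by eventually_elim simp
  note fg = integral_H2_quotient[OF f f_le g le ge G_ge]
  note gf = integral_H2_quotient[OF g le f f_le f_ge F_ge]
  define Q where "Q = Re (H2_ext f 0) / Re (H2_ext g 0)"
  have Q: "0 < Q" using F0 G0 by (simp add: Q_def)
  have Fr: "H2_ext f 0 = of_real (Re (H2_ext f 0))" and Gr: "H2_ext g 0 = of_real (Re (H2_ext g 0))"
    using F0 G0 by (simp_all add: complex_eq_iff)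
  have "H2_ext f 0 / H2_ext g 0 = of_real Q" "H2_ext g 0 / H2_ext f 0 = of_real (1 / Q)"
    by (subst Fr, subst Gr, simp add: Q_def)+
  then have Q1: "(\<integral>t. Re (f (cis t) / g (cis t)) \<partial>circ_meas) = 2 * pi * Q"
    and Q2: "(\<integral>t. Re (g (cis t) / f (cis t)) \<partial>circ_meas) = 2 * pi * (1 / Q)"
    using fg gf by simp_all
  \<comment> \<open>Equal moduli make \<open>f / g\<close> unimodular, so its inverse is its
    conjugate and both quotients have the same real part; comparing their means yields
    \<open>1 / Q = Q\<close>.\<close>
  have quot: "AE t in circ_meas. cmod (f (cis t) / g (cis t)) = 1 \<and> g (cis t) / f (cis t) = cnj (f (cis t) / g (cis t))"
    using eq ge
  proof eventually_elim
    case (elim t)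
    then have nz: "g (cis t) \<noteq> 0" "f (cis t) \<noteq> 0" by auto
    have "f (cis t) * cnj (f (cis t)) = g (cis t) * cnj (g (cis t))"
      using elim by (simp flip: complex_norm_square)
    then show ?case using elim nz by (simp add: norm_divide field_simps)
  qed
  have "(\<integral>t. Re (g (cis t) / f (cis t)) \<partial>circ_meas) = (\<integral>t. Re (f (cis t) / g (cis t)) \<partial>circ_meas)"
  proof (rule integral_cong_AE)
    show "AE t in circ_meas. Re (g (cis t) / f (cis t)) = Re (f (cis t) / g (cis t))"
      using quot
    proof eventually_elim
      case (elim t)
      then have "Re (g (cis t) / f (cis t)) = Re (cnj (f (cis t) / g (cis t)))" by metis
      then show ?case by (simp only: cnj.simps)
    qed
  qed (use fg(1) gf(1) in auto)
  then have "2 * pi * (1 / Q) = 2 * pi * Q" unfolding Q1 Q2 .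
  then have "1 / Q = Q" by (subst (asm) mult_cancel_left) simp
  then have "Q * Q = 1" using Q by (simp add: field_simps)
  then have "Q\<^sup>2 = 1" by (simp add: power2_eq_square)
  then have "Q = 1" using Q by (auto simp: power2_eq_1_iff)
  \<comment> \<open>The integrand is nonnegative almost everywhere because the quotient is
    unimodular, and its integral is \<open>2 * pi - 2 * pi * Q = 0\<close>; hence it vanishes almost
    everywhere.\<close>
  then have "(\<integral>t. 1 - Re (f (cis t) / g (cis t)) \<partial>circ_meas) = 0"
    using fg(1) Q1 by simp
  moreover have "AE t in circ_meas. 0 \<le> 1 - Re (f (cis t) / g (cis t))"
    using quot
  proof eventually_elim
    case (elim t)
    then show ?case using complex_Re_le_cmod[of "f (cis t) / g (cis t)"] by simp
  qed
  ultimately have "AE t in circ_meas. 1 - Re (f (cis t) / g (cis t)) = 0"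
    using fg(1) by (subst (asm) integral_nonneg_eq_0_iff_AE) auto
  then show ?thesis using quot ge
  proof eventually_elim
    case (elim t)
    define y where "y = f (cis t) / g (cis t)"
    have y: "Re y = 1" "cmod y = 1" using elim by (auto simp: y_def)
    then have "(Im y)\<^sup>2 = 0" using cmod_power2[of y] by simp
    then have "y = 1" using y by (simp add: complex_eq_iff)
    then show ?case using elim by (auto simp: y_def)
  qed
qed

text \<open>Reflection in the circle translates the conditions on \<open>a\<close> in the exterior
  disc into conditions on \<open>cstar a\<close> in the disc, where the holomorphic arguments take
  place; the bound on the infimum becomes a bound at each point.\<close>

lemma B_pairs_D:
  assumes "(a, b) \<in> B_pairs"
  shows "H2_D (cstar a)" "Im (H2_ext (cstar a) 0) = 0" "0 < Re (H2_ext (cstar a) 0)"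
    and "AE t in circ_meas. (cmod (cstar a (cis t)))\<^sup>2 = 1 - (cmod (b (cis t)))\<^sup>2"
    and "\<And>z. cmod z < 1 \<Longrightarrow> 1/2 \<le> (cmod (H2_ext (cstar a) z))\<^sup>2"
proof -
  have L: "(a, b) \<in> L_pairs" using assms by (simp add: B_pairs_def)
  then show "H2_D (cstar a)" "Im (H2_ext (cstar a) 0) = 0" "0 < Re (H2_ext (cstar a) 0)"
    by (simp_all add: L_pairs_def H2_Dstar_def at_infty_def)
  have "AE t in circ_meas. a (cis t) * cstar a (cis t) + b (cis t) * cstar b (cis t) = 1"
    using L by (simp add: L_pairs_def)
  then show "AE t in circ_meas. (cmod (cstar a (cis t)))\<^sup>2 = 1 - (cmod (b (cis t)))\<^sup>2"
  proof eventually_elim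
    case (elim t)
    then have "complex_of_real ((cmod (a (cis t)))\<^sup>2 + (cmod (b (cis t)))\<^sup>2) = of_real 1"
      by (simp only: cstar_cis of_real_add complex_norm_square of_real_1)
    then show ?case by (simp only: of_real_eq_iff cstar_cis complex_mod_cnj)
  qed
  let ?S = "(\<lambda>w. (cmod (Dstar_ext a w))\<^sup>2) ` {w. 1 < cmod w} \<union> {(cmod (at_infty a))\<^sup>2}"
  fix z :: complex assume z: "cmod z < 1"
  have "(cmod (H2_ext (cstar a) z))\<^sup>2 \<in> ?S"
  \<comment> \<open>The point 0 is the reflection of infinity; any other \<open>z\<close> is the
    reflection of \<open>1 / cnj z\<close>.\<close>
  proof (cases "z = 0")
    case True
    then show ?thesis by (simp add: at_infty_def)
  next
    case False
    have "Dstar_ext a (1 / cnj z) = cnj (H2_ext (cstar a) z)" by (simp add: Dstar_ext_def)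
    then have "(cmod (Dstar_ext a (1 / cnj z)))\<^sup>2 = (cmod (H2_ext (cstar a) z))\<^sup>2" by simp
    moreover have "1 < cmod (1 / cnj z)" using z False by (simp add: norm_divide)
    ultimately show ?thesis by (metis (mono_tags, lifting) UnI1 image_eqI mem_Collect_eq)
  qed
  moreover have "bdd_below ?S" by (rule bdd_belowI[of _ 0]) auto
  ultimately have "Inf ?S \<le> (cmod (H2_ext (cstar a) z))\<^sup>2" by (rule cInf_lower)
  then show "1/2 \<le> (cmod (H2_ext (cstar a) z))\<^sup>2" using assms by (simp add: B_pairs_def)
qed

theorem theorem7p1:
  fixes b :: "complex \<Rightarrow> complex"
  assumes "T_measurable b"
    and "esssup circ_meas (\<lambda>t. ereal ((cmod (b (cis t)))^2)) < ereal (1/2)"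
  shows "(\<exists>a. T_measurable a \<and> (a, b) \<in> B_pairs) \<and>
         (\<forall>a1 a2. T_measurable a1 \<and> (a1, b) \<in> B_pairs \<and> T_measurable a2 \<and> (a2, b) \<in> B_pairs
            \<longrightarrow> (AE t in circ_meas. a1 (cis t) = a2 (cis t)))"
proof -
  \<comment> \<open>The maximum with 0 ensures that \<open>c\<close> is positive, and choosing
    \<open>c\<close> strictly between leaves a gap below \<open>1/2\<close>.\<close>
  have "max 0 (esssup circ_meas (\<lambda>t. ereal ((cmod (b (cis t)))^2))) < ereal (1/2)"
    using assms(2) by (simp add: zero_ereal_def)
  then obtain c where c: "max 0 (esssup circ_meas (\<lambda>t. ereal ((cmod (b (cis t)))^2))) < ereal c" "ereal c < ereal (1/2)"
    using ereal_dense2 by blast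
  then have c': "0 < c" "c < 1/2" by (auto simp: zero_ereal_def)
  have bc: "AE t in circ_meas. (cmod (b (cis t)))\<^sup>2 \<le> c"
    using esssup_AE[of "\<lambda>t. ereal ((cmod (b (cis t)))^2)" circ_meas]
  proof eventually_elim
    case (elim t)
    then have "ereal ((cmod (b (cis t)))\<^sup>2) \<le> ereal c" using c(1) by (meson less_imp_le max.strict_boundedE order_trans)
    then show ?case by simp
  qed
  have "AE t in circ_meas. a1 (cis t) = a2 (cis t)"
    if "(a1, b) \<in> B_pairs" "(a2, b) \<in> B_pairs" for a1 a2
  proof -
    note f = B_pairs_D[OF that(1)] and g = B_pairs_D[OF that(2)]
    have eq: "AE t in circ_meas. cmod (cstar a1 (cis t)) = cmod (cstar a2 (cis t))"
      using f(4) g(4)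
    proof eventually_elim
      case (elim t)
      then have "(cmod (cstar a1 (cis t)))\<^sup>2 = (cmod (cstar a2 (cis t)))\<^sup>2" by simp
      then show ?case by (simp only: power2_eq_iff_nonneg norm_ge_zero)
    qed
    have le: "AE t in circ_meas. cmod (cstar a2 (cis t)) \<le> 1"
      using g(4) by eventually_elim (rule power2_le_imp_le, auto)
    have ge: "AE t in circ_meas. 1/2 \<le> (cmod (cstar a2 (cis t)))\<^sup>2"
      using g(4) bc by eventually_elim (use c' in simp)
    have "AE t in circ_meas. cstar a1 (cis t) = cstar a2 (cis t)"
      by (rule H2_D_unique_of_modulus[OF f(1) g(1) eq le ge f(5) g(5) f(2,3) g(2,3)])
    then show ?thesis by eventually_elim (simp add: cstar_cis)
  qed
  then show ?thesis using B_pairs_exists[OF assms(1) c' bc] by blast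
qed

end
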